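(* Consider the neutral type system $$\dot z(t)=A_{-1}\dot z(t-1)+\int_{-1}^0\left[A_2(\theta)\dot z(t+\theta)+A_3(\theta)z(t+\theta)\right]d\theta+Bu(t),$$ with $z(t)\in\mathbb R^n$, $u(t)\in\mathbb R^m$, where $A_{-1}$ is a constant real $n\times n$ matrix, $B$ is a constant real $n\times m$ matrix, and $A_2,A_3$ are $n\times n$ matrix functions with entries in $L_2(-1,0)$. Let $$\Delta_{\mathcal A}(\lambda)=\lambda I-\lambda e^{-\lambda}A_{-1}-\int_{-1}^0\left[\lambda e^{\lambda s}A_2(s)+e^{\lambda s}A_3(s)\right]ds,\qquad\lambda\in\mathbb C.$$ If the system is exactly null controllable, then the following two conditions hold: 1. $\mathrm{rank}\begin{pmatrix}\Delta_{\mathcal A}(\lambda)& B\end{pmatrix}=n$ for all $\lambda\in\mathbb C$; 2. $\mathrm{rank}\begin{pmatrix}\mu I-A_{-1}& B\end{pmatrix}=n$ for all $\mu\in\mathbb C$, $\mu\neq0$.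
   Context: The system is represented in the Hilbert space $M_2=\mathbb R^n\times L_2(-1,0;\mathbb R^n)$ as $\dot x(t)=\mathcal A x(t)+\mathcal B u(t)$, with $x(t)=(v(t),z_t(\cdot))$, $z_t(\theta)=z(t+\theta)$, $\mathcal B u=(Bu,0)$ and $$\mathcal A\begin{pmatrix}v\\ \varphi\end{pmatrix}=\begin{pmatrix}\int_{-1}^0[A_2(\theta)\varphi'(\theta)+A_3(\theta)\varphi(\theta)]\,d\theta\\ \varphi'\end{pmatrix},\qquad D(\mathcal A)=\{(v,\varphi):\varphi\in H^1(-1,0;\mathbb R^n),\ v=\varphi(0)-A_{-1}\varphi(-1)\}.$$ The operator $\mathcal A$ generates a $C_0$-semigroup $e^{\mathcal A t}$ on $M_2$. The system is exactly null controllable if for some $T>0$ and for all $x_0\in M_2$ there is a control $u\in L_2(0,T;\mathbb R^m)$ such that $e^{\mathcal A T}x_0+\int_0^T e^{\mathcal A(T-\tau)}\mathcal B u(\tau)\,d\tau=0$. *)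

theory Defs
  imports "HOL-Analysis.Analysis"
begin

definition square_integrable :: "'a measure \<Rightarrow> ('a \<Rightarrow> 'b::euclidean_space) \<Rightarrow> bool" where
  "square_integrable M f \<longleftrightarrow> f \<in> borel_measurable M \<and> integrable M (\<lambda>x. (norm (f x))\<^sup>2)"

lemma square_integrable_measurable [measurable_dest]:
  "square_integrable M f \<Longrightarrow> f \<in> borel_measurable M"
  by (simp add: square_integrable_def)

lemma square_integrable_norm2: "square_integrable M f \<Longrightarrow> integrable M (\<lambda>x. (norm (f x))\<^sup>2)"
  by (simp add: square_integrable_def)

lemma square_integrable_inner:
  assumes "square_integrable M f" "square_integrable M g"
  shows "integrable M (\<lambda>x. f x \<bullet> g x)"
proof (rule Bochner_Integration.integrable_bound)
  show "integrable M (\<lambda>x. (norm (f x))\<^sup>2 + (norm (g x))\<^sup>2)"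
    using assms by (simp add: square_integrable_def)
  show "(\<lambda>x. f x \<bullet> g x) \<in> borel_measurable M"
    using assms by (auto simp: square_integrable_def)
  have "\<bar>f x \<bullet> g x\<bar> \<le> (norm (f x))\<^sup>2 + (norm (g x))\<^sup>2" for x
  proof -
    have "\<bar>f x \<bullet> g x\<bar> \<le> norm (f x) * norm (g x)" by (rule Cauchy_Schwarz_ineq2)
    also have "\<dots> \<le> (norm (f x))\<^sup>2 + (norm (g x))\<^sup>2"
      using sum_squares_bound[of "norm (f x)" "norm (g x)"]
        mult_nonneg_nonneg[OF norm_ge_zero norm_ge_zero, of "f x" "g x"] by linarith
    finally show ?thesis .
  qed
  then show "AE x in M. norm (f x \<bullet> g x) \<le> norm ((norm (f x))\<^sup>2 + (norm (g x))\<^sup>2)"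
    by simp
qed

lemma square_integrable_add:
  assumes "square_integrable M f" "square_integrable M g"
  shows "square_integrable M (\<lambda>x. f x + g x)"
proof -
  have "integrable M (\<lambda>x. (norm (f x))\<^sup>2 + (norm (g x))\<^sup>2 + 2 * (f x \<bullet> g x))"
    using assms square_integrable_inner[OF assms] by (simp add: square_integrable_def)
  also have "(\<lambda>x. (norm (f x))\<^sup>2 + (norm (g x))\<^sup>2 + 2 * (f x \<bullet> g x)) = (\<lambda>x. (norm (f x + g x))\<^sup>2)"
    by (rule ext) (simp add: power2_norm_eq_inner inner_add_left inner_add_right inner_commute)
  finally have "integrable M (\<lambda>x. (norm (f x + g x))\<^sup>2)" .
  moreover have "(\<lambda>x. f x + g x) \<in> borel_measurable M"
    using assms by (intro borel_measurable_add) (auto simp: square_integrable_def)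
  ultimately show ?thesis
    unfolding square_integrable_def by (rule conjI[rotated])
qed

lemma square_integrable_scaleR:
  "square_integrable M f \<Longrightarrow> square_integrable M (\<lambda>x. c *\<^sub>R f x)"
  by (auto simp: square_integrable_def power_mult_distrib intro!: borel_measurable_scaleR)

lemma square_integrable_uminus:
  "square_integrable M f \<Longrightarrow> square_integrable M (\<lambda>x. - f x)"
  by (simp add: square_integrable_def)

lemma square_integrable_diff:
  assumes "square_integrable M f" "square_integrable M g"
  shows "square_integrable M (\<lambda>x. f x - g x)"
  using square_integrable_add[OF assms(1) square_integrable_uminus[OF assms(2)]] by simp

lemma square_integrable_zero [simp]: "square_integrable M (\<lambda>x. 0)"
  by (simp add: square_integrable_def)

text \<open>
  The Hilbert space \<open>L\<^sub>2(-1,0;'a)\<close> as a type: Lebesgue square-integrable functions modulo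
  equality almost everywhere on \<open>[-1, 0]\<close>. The endpoints form a null set. Completeness and
  separability, proved below, make the library's Bochner integral available for functions with
  values in this space.
\<close>

abbreviation hist_measure :: "real measure" where
  "hist_measure \<equiv> lebesgue_on {-1..0}"

quotient_type (overloaded) 'a L2_hist = "real \<Rightarrow> 'a::euclidean_space" / partial:
  "\<lambda>f g. square_integrable hist_measure f \<and> square_integrable hist_measure g \<and>
         (AE \<theta> in hist_measure. f \<theta> = g \<theta>)"
proof (rule part_equivpI)
  show "\<exists>f. square_integrable hist_measure f \<and> square_integrable hist_measure f \<and>
         (AE \<theta> in hist_measure. f \<theta> = f \<theta>)"
    by (rule exI[of _ "\<lambda>_. 0"]) simp
qed (auto simp: symp_def transp_def elim: AE_mp)

instantiation L2_hist :: (euclidean_space) real_inner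
begin

lift_definition zero_L2_hist :: "'a L2_hist" is "\<lambda>_. 0" by simp

lift_definition plus_L2_hist :: "'a L2_hist \<Rightarrow> 'a L2_hist \<Rightarrow> 'a L2_hist" is "\<lambda>f g x. f x + g x"
  by (auto intro: square_integrable_add)

lift_definition minus_L2_hist :: "'a L2_hist \<Rightarrow> 'a L2_hist \<Rightarrow> 'a L2_hist" is "\<lambda>f g x. f x - g x"
  by (auto intro: square_integrable_diff)

lift_definition uminus_L2_hist :: "'a L2_hist \<Rightarrow> 'a L2_hist" is "\<lambda>f x. - f x"
  by (auto intro: square_integrable_uminus)

lift_definition scaleR_L2_hist :: "real \<Rightarrow> 'a L2_hist \<Rightarrow> 'a L2_hist" is "\<lambda>c f x. c *\<^sub>R f x"
  by (auto intro: square_integrable_scaleR)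

lift_definition inner_L2_hist :: "'a L2_hist \<Rightarrow> 'a L2_hist \<Rightarrow> real" is
  "\<lambda>f g. LINT \<theta>|hist_measure. f \<theta> \<bullet> g \<theta>"
  by (rule integral_cong_AE) (auto simp: square_integrable_def)

definition norm_L2_hist :: "'a L2_hist \<Rightarrow> real" where
  "norm_L2_hist x = sqrt (x \<bullet> x)"

definition sgn_L2_hist :: "'a L2_hist \<Rightarrow> 'a L2_hist" where
  "sgn_L2_hist x = inverse (norm x) *\<^sub>R x"

definition dist_L2_hist :: "'a L2_hist \<Rightarrow> 'a L2_hist \<Rightarrow> real" where
  "dist_L2_hist x y = norm (x - y)"

definition uniformity_L2_hist :: "('a L2_hist \<times> 'a L2_hist) filter" where
  "uniformity_L2_hist = (INF e\<in>{0<..}. principal {(x, y). dist x y < e})"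

definition open_L2_hist :: "'a L2_hist set \<Rightarrow> bool" where
  "open_L2_hist U \<longleftrightarrow> (\<forall>x\<in>U. eventually (\<lambda>(x', y). x' = x \<longrightarrow> y \<in> U) uniformity)"

instance
proof
  fix x y z :: "'a L2_hist" and a b :: real and U :: "'a L2_hist set"
  show "x + y + z = x + (y + z)"
    by transfer (auto intro!: square_integrable_add simp: add.assoc)
  show "x + y = y + x"
    by transfer (auto intro!: square_integrable_add simp: add.commute)
  show "0 + x = x"
    by transfer auto
  show "- x + x = 0"
    by transfer auto
  show "x - y = x + - y"
    by transfer (auto intro!: square_integrable_diff)
  show "a *\<^sub>R (x + y) = a *\<^sub>R x + a *\<^sub>R y"
    by transfer (auto intro!: square_integrable_add square_integrable_scaleR simp: scaleR_add_right)
  show "(a + b) *\<^sub>R x = a *\<^sub>R x + b *\<^sub>R x"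
    by transfer (auto intro!: square_integrable_add square_integrable_scaleR simp: scaleR_add_left)
  show "a *\<^sub>R b *\<^sub>R x = (a * b) *\<^sub>R x"
    by transfer (auto intro!: square_integrable_scaleR)
  show "1 *\<^sub>R x = x"
    by transfer auto
  show "dist x y = norm (x - y)" by (simp add: dist_L2_hist_def)
  show "sgn x = inverse (norm x) *\<^sub>R x" by (simp add: sgn_L2_hist_def)
  show "uniformity = (INF e\<in>{0<..}. principal {(x, y :: 'a L2_hist). dist x y < e})"
    by (simp add: uniformity_L2_hist_def)
  show "open U \<longleftrightarrow> (\<forall>x\<in>U. \<forall>\<^sub>F (x', y) in uniformity. x' = x \<longrightarrow> y \<in> U)"
    by (simp add: open_L2_hist_def)
  show "x \<bullet> y = y \<bullet> x"
    by transfer (simp add: inner_commute)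
  show "(x + y) \<bullet> z = x \<bullet> z + y \<bullet> z"
    by transfer (simp add: inner_add_left square_integrable_inner)
  show "a *\<^sub>R x \<bullet> y = a * (x \<bullet> y)"
    by transfer simp
  show "0 \<le> x \<bullet> x"
    by transfer simp
  show "x \<bullet> x = 0 \<longleftrightarrow> x = 0"
  proof transfer
    fix f :: "real \<Rightarrow> 'a"
    assume *: "square_integrable hist_measure f \<and> square_integrable hist_measure f \<and>
      (AE \<theta> in hist_measure. f \<theta> = f \<theta>)"
    then have "(LINT \<theta>|hist_measure. f \<theta> \<bullet> f \<theta>) = 0 \<longleftrightarrow> (AE \<theta> in hist_measure. f \<theta> \<bullet> f \<theta> = 0)"
      by (intro integral_nonneg_eq_0_iff_AE) (auto intro: square_integrable_inner)
    with * show "(LINT \<theta>|hist_measure. f \<theta> \<bullet> f \<theta>) = 0 \<longleftrightarrow>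
      square_integrable hist_measure f \<and> square_integrable hist_measure (\<lambda>_. 0::'a) \<and>
      (AE \<theta> in hist_measure. f \<theta> = 0)"
      by simp
  qed
  show "norm x = sqrt (x \<bullet> x)" by (simp add: norm_L2_hist_def)
qed

end

lemma norm_L2_hist_abs:
  assumes "square_integrable hist_measure f"
  shows "(norm (abs_L2_hist f))\<^sup>2 = (LINT \<theta>|hist_measure. (norm (f \<theta>))\<^sup>2)"
proof -
  have "abs_L2_hist f \<bullet> abs_L2_hist f = (LINT \<theta>|hist_measure. f \<theta> \<bullet> f \<theta>)"
    by (rule inner_L2_hist.abs_eq) (use assms in auto)
  then show ?thesis
    by (simp add: power2_norm_eq_inner)
qed

lemma L2_hist_abs_diff:
  assumes "square_integrable hist_measure f" "square_integrable hist_measure g"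
  shows "abs_L2_hist f - abs_L2_hist g = abs_L2_hist (\<lambda>x. f x - g x)"
  by (rule minus_L2_hist.abs_eq) (use assms in auto)

lemma L2_hist_abs_add:
  assumes "square_integrable hist_measure f" "square_integrable hist_measure g"
  shows "abs_L2_hist f + abs_L2_hist g = abs_L2_hist (\<lambda>x. f x + g x)"
  by (rule plus_L2_hist.abs_eq) (use assms in auto)

lemma L2_hist_abs_scaleR:
  assumes "square_integrable hist_measure f"
  shows "c *\<^sub>R abs_L2_hist f = abs_L2_hist (\<lambda>x. c *\<^sub>R f x)"
  by (rule scaleR_L2_hist.abs_eq) (use assms in auto)

lemma L2_hist_cases:
  obtains f where "square_integrable hist_measure f" "x = abs_L2_hist f"
proof -
  have "square_integrable hist_measure (rep_L2_hist x)"
    using Quotient3_rep_reflp[OF Quotient3_L2_hist, of x] by blast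
  moreover have "x = abs_L2_hist (rep_L2_hist x)"
    using Quotient3_abs_rep[OF Quotient3_L2_hist, of x] by (rule sym)
  ultimately show ?thesis by (rule that)
qed

lemma L2_hist_integrable_norm:
  assumes "square_integrable hist_measure f"
  shows "integrable hist_measure (\<lambda>x. norm (f x))"
proof (rule Bochner_Integration.integrable_bound)
  have "integrable hist_measure (\<lambda>x. 1::real)"
    by (simp add: integrable_restrict_UNIV)
  then show "integrable hist_measure (\<lambda>x. 1 + (norm (f x))\<^sup>2)"
    using square_integrable_norm2[OF assms] by simp
  show "(\<lambda>x. norm (f x)) \<in> borel_measurable hist_measure"
    using assms by (auto simp: square_integrable_def)
  have "norm (f x) \<le> 1 + (norm (f x))\<^sup>2" for x
    using sum_squares_bound[of "norm (f x)" 1] norm_ge_zero[of "f x"] by (simp del: norm_ge_zero)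
  then show "AE x in hist_measure. norm (norm (f x)) \<le> norm (1 + (norm (f x))\<^sup>2)"
    by (simp add: add_nonneg_nonneg)
qed

lemma L2_hist_norm_integral:
  assumes "square_integrable hist_measure f"
  shows "(LINT x|hist_measure. norm (f x)) \<le> norm (abs_L2_hist f)"
proof -
  have one: "integrable hist_measure (\<lambda>x. 1::real)"
    by (simp add: integrable_restrict_UNIV)
  have meas: "(LINT x|hist_measure. 1::real) = 1"
    by (simp add: measure_restrict_space)
  define m where "m = (LINT x|hist_measure. norm (f x))"
  note int = L2_hist_integrable_norm[OF assms] square_integrable_norm2[OF assms] one
  have "0 \<le> (LINT x|hist_measure. (norm (f x) - m)\<^sup>2)"
    by simp
  also have "\<dots> = (LINT x|hist_measure. (norm (f x))\<^sup>2 + m\<^sup>2 * 1 - 2 * m * norm (f x))"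
    by (rule Bochner_Integration.integral_cong) (auto simp: power2_eq_square algebra_simps)
  also have "\<dots> = (LINT x|hist_measure. (norm (f x))\<^sup>2) + m\<^sup>2 * (LINT x|hist_measure. 1::real)
      - 2 * m * (LINT x|hist_measure. norm (f x))"
    using int by (subst Bochner_Integration.integral_diff, simp, simp)
      (subst Bochner_Integration.integral_add, simp_all)
  also have "\<dots> = (norm (abs_L2_hist f))\<^sup>2 - m\<^sup>2"
    unfolding meas norm_L2_hist_abs[OF assms] m_def[symmetric] by (simp add: power2_eq_square)
  finally have "m\<^sup>2 \<le> (norm (abs_L2_hist f))\<^sup>2" by simp
  then show ?thesis
    unfolding m_def[symmetric] by (rule power2_le_imp_le) simp
qed

lemma L2_hist_dominated:
  fixes f :: "real \<Rightarrow> 'a::euclidean_space"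
  assumes f: "square_integrable hist_measure f" and h: "square_integrable hist_measure h"
    and g: "\<And>n. g n \<in> borel_measurable hist_measure"
    and lim: "AE x in hist_measure. (\<lambda>n. g n x) \<longlonglongrightarrow> f x"
    and bound: "\<And>n. AE x in hist_measure. norm (g n x) \<le> norm (h x)"
  shows "\<And>n. square_integrable hist_measure (g n)"
    and "(\<lambda>n. abs_L2_hist (g n)) \<longlonglongrightarrow> abs_L2_hist f"
proof -
  have sq: "square_integrable hist_measure (g n)" for n
    unfolding square_integrable_def
  proof
    show "integrable hist_measure (\<lambda>x. (norm (g n x))\<^sup>2)"
    proof (rule Bochner_Integration.integrable_bound[OF square_integrable_norm2[OF h]])
      show "(\<lambda>x. (norm (g n x))\<^sup>2) \<in> borel_measurable hist_measure"
        using g[of n] by measurable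
      show "AE x in hist_measure. norm ((norm (g n x))\<^sup>2) \<le> norm ((norm (h x))\<^sup>2)"
        using bound[of n] by eventually_elim (simp add: power_mono)
    qed
  qed (rule g)
  show "square_integrable hist_measure (g n)" for n by (rule sq)
  have d: "square_integrable hist_measure (\<lambda>x. g n x - f x)" for n
    by (rule square_integrable_diff[OF sq f])
  have "(\<lambda>n. LINT x|hist_measure. (norm (g n x - f x))\<^sup>2) \<longlonglongrightarrow> (LINT x|hist_measure. 0)"
  proof (rule integral_dominated_convergence
      [where w = "\<lambda>x. 2 * (norm (h x))\<^sup>2 + 2 * (norm (f x))\<^sup>2"])
    show "integrable hist_measure (\<lambda>x. 2 * (norm (h x))\<^sup>2 + 2 * (norm (f x))\<^sup>2)"
      using f h by (simp add: square_integrable_def)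
    show "(\<lambda>x. (norm (g n x - f x))\<^sup>2) \<in> borel_measurable hist_measure" for n
      using square_integrable_norm2[OF d[of n]] by simp
    show "AE x in hist_measure. (\<lambda>n. (norm (g n x - f x))\<^sup>2) \<longlonglongrightarrow> 0"
      using lim
    proof eventually_elim
      case (elim x)
      then have "(\<lambda>n. (norm (g n x - f x))\<^sup>2) \<longlonglongrightarrow> (norm (f x - f x))\<^sup>2"
        by (intro tendsto_intros)
      then show ?case by simp
    qed
    show "AE x in hist_measure. norm ((norm (g n x - f x))\<^sup>2) \<le>
        2 * (norm (h x))\<^sup>2 + 2 * (norm (f x))\<^sup>2" for n
      using bound[of n]
    proof eventually_elim
      case (elim x)
      have "(norm (g n x - f x))\<^sup>2 \<le> (norm (g n x) + norm (f x))\<^sup>2"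
        by (intro power_mono norm_triangle_ineq4) auto
      also have "\<dots> \<le> 2 * (norm (g n x))\<^sup>2 + 2 * (norm (f x))\<^sup>2"
        using sum_squares_bound[of "norm (g n x)" "norm (f x)"]
        by (simp add: power2_sum)
      also have "(norm (g n x))\<^sup>2 \<le> (norm (h x))\<^sup>2"
        using elim by (intro power_mono) auto
      finally show ?case by simp
    qed
  qed auto
  then have "(\<lambda>n. (norm (abs_L2_hist (g n) - abs_L2_hist f))\<^sup>2) \<longlonglongrightarrow> 0"
    by (simp add: L2_hist_abs_diff[OF sq f] norm_L2_hist_abs[OF d])
  then have "(\<lambda>n. sqrt ((norm (abs_L2_hist (g n) - abs_L2_hist f))\<^sup>2)) \<longlonglongrightarrow> sqrt 0"
    by (rule tendsto_real_sqrt)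
  then show "(\<lambda>n. abs_L2_hist (g n)) \<longlonglongrightarrow> abs_L2_hist f"
    by (simp add: LIM_zero_cancel tendsto_norm_zero_iff)
qed

lemma L2_hist_norm_le:
  assumes "square_integrable hist_measure f"
    and "(\<integral>\<^sup>+x. ennreal ((norm (f x))\<^sup>2) \<partial>hist_measure) \<le> ennreal (c\<^sup>2)" "c \<ge> 0"
  shows "norm (abs_L2_hist f) \<le> c"
proof -
  have "ennreal (LINT x|hist_measure. (norm (f x))\<^sup>2) \<le> ennreal (c\<^sup>2)"
    using assms(2) nn_integral_eq_integral[OF square_integrable_norm2[OF assms(1)]] by simp
  then have "(norm (abs_L2_hist f))\<^sup>2 \<le> c\<^sup>2"
    by (simp add: norm_L2_hist_abs[OF assms(1)])
  then show ?thesis using assms(3) by (rule power2_le_imp_le)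
qed

lemma L2_hist_nn_integral:
  assumes "square_integrable hist_measure f"
  shows "(\<integral>\<^sup>+x. ennreal ((norm (f x))\<^sup>2) \<partial>hist_measure) = ennreal ((norm (abs_L2_hist f))\<^sup>2)"
  using nn_integral_eq_integral[OF square_integrable_norm2[OF assms]]
  by (simp add: norm_L2_hist_abs[OF assms])

lemma L2_hist_fast_Cauchy:
  fixes Y :: "nat \<Rightarrow> 'a::euclidean_space L2_hist"
  assumes Y: "\<And>m n. n \<le> m \<Longrightarrow> norm (Y m - Y n) \<le> (1/2) ^ n"
  shows "convergent Y"
proof -
  have "\<forall>n. \<exists>f. square_integrable hist_measure f \<and> Y n = abs_L2_hist f"
    by (metis L2_hist_cases)
  then obtain f where f: "\<And>n. square_integrable hist_measure (f n)" "\<And>n. Y n = abs_L2_hist (f n)"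
    by metis
  have f_meas [measurable]: "f n \<in> borel_measurable hist_measure" for n
    using f(1) by (simp add: square_integrable_def)
  have d: "square_integrable hist_measure (\<lambda>x. f m x - f n x)" for m n
    by (rule square_integrable_diff[OF f(1) f(1)])
  have Yd: "Y m - Y n = abs_L2_hist (\<lambda>x. f m x - f n x)" for m n
    by (simp add: f L2_hist_abs_diff)
  have "(\<integral>\<^sup>+x. (\<Sum>n. ennreal (norm (f (Suc n) x - f n x))) \<partial>hist_measure)
      = (\<Sum>n. \<integral>\<^sup>+x. ennreal (norm (f (Suc n) x - f n x)) \<partial>hist_measure)"
    by (rule nn_integral_suminf) measurable
  also have "\<dots> \<le> (\<Sum>n. ennreal ((1/2) ^ n))"
  proof (intro suminf_le summableI)
    fix n
    have "(LINT x|hist_measure. norm (f (Suc n) x - f n x)) \<le> (1/2) ^ n"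
      using L2_hist_norm_integral[OF d[of "Suc n" n]] Y[of n "Suc n"] by (simp add: Yd)
    then show "(\<integral>\<^sup>+x. ennreal (norm (f (Suc n) x - f n x)) \<partial>hist_measure) \<le> ennreal ((1/2) ^ n)"
      using nn_integral_eq_integral[OF L2_hist_integrable_norm[OF d[of "Suc n" n]]]
      by (simp add: ennreal_leI)
  qed
  also have "\<dots> = ennreal (\<Sum>n. (1/2::real) ^ n)"
    by (rule suminf_ennreal2) (auto simp: summable_geometric)
  also have "\<dots> < \<infinity>" by simp
  finally have "AE x in hist_measure. (\<Sum>n. ennreal (norm (f (Suc n) x - f n x))) \<noteq> \<infinity>"
    by (intro nn_integral_PInf_AE) (auto intro!: borel_measurable_suminf_order)
  then have conv: "AE x in hist_measure. convergent (\<lambda>n. f n x)"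
  proof eventually_elim
    case (elim x)
    then have "summable (\<lambda>n. norm (f (Suc n) x - f n x))"
      by (intro summable_suminf_not_top) auto
    then have "summable (\<lambda>n. f (Suc n) x - f n x)"
      by (rule summable_norm_cancel)
    then have "(\<lambda>n. \<Sum>i<n. f (Suc i) x - f i x) \<longlonglongrightarrow> (\<Sum>n. f (Suc n) x - f n x)"
      by (rule summable_LIMSEQ)
    then have "(\<lambda>n. f n x - f 0 x) \<longlonglongrightarrow> (\<Sum>n. f (Suc n) x - f n x)"
      by (simp only: sum_lessThan_telescope[where f = "\<lambda>n. f n x"])
    from tendsto_add[OF this tendsto_const[of "f 0 x"]] show ?case
      by (auto simp: convergent_def)
  qed
  define F where "F x = lim (\<lambda>n. f n x)" for x
  have F_meas [measurable]: "F \<in> borel_measurable hist_measure"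
    unfolding F_def by (rule borel_measurable_lim_metric) measurable
  have F_lim: "AE x in hist_measure. (\<lambda>n. f n x) \<longlonglongrightarrow> F x"
    using conv by eventually_elim (simp add: F_def convergent_LIMSEQ_iff)
  have bd: "(\<integral>\<^sup>+x. ennreal ((norm (F x - f n x))\<^sup>2) \<partial>hist_measure) \<le> ennreal (((1/2) ^ n)\<^sup>2)" for n
  proof -
    have "(\<integral>\<^sup>+x. ennreal ((norm (F x - f n x))\<^sup>2) \<partial>hist_measure)
        = (\<integral>\<^sup>+x. liminf (\<lambda>m. ennreal ((norm (f m x - f n x))\<^sup>2)) \<partial>hist_measure)"
    proof (rule nn_integral_cong_AE, use F_lim in eventually_elim)
      case (elim x)
      then have "(\<lambda>m. ennreal ((norm (f m x - f n x))\<^sup>2)) \<longlonglongrightarrow> ennreal ((norm (F x - f n x))\<^sup>2)"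
        by (intro tendsto_intros)
      from lim_imp_Liminf[OF _ this] show ?case by simp
    qed
    also have "\<dots> \<le> liminf (\<lambda>m. \<integral>\<^sup>+x. ennreal ((norm (f m x - f n x))\<^sup>2) \<partial>hist_measure)"
      by (rule nn_integral_liminf) measurable
    also have "\<dots> \<le> liminf (\<lambda>m. ennreal (((1/2) ^ n)\<^sup>2))"
    proof (rule Liminf_mono)
      show "\<forall>\<^sub>F m in sequentially. (\<integral>\<^sup>+x. ennreal ((norm (f m x - f n x))\<^sup>2) \<partial>hist_measure)
          \<le> ennreal (((1/2) ^ n)\<^sup>2)"
        using eventually_ge_at_top[of n]
      proof eventually_elim
        case (elim m)
        have "(norm (Y m - Y n))\<^sup>2 \<le> ((1/2) ^ n)\<^sup>2"
          by (intro power_mono Y elim) auto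
        then show ?case
          by (simp add: L2_hist_nn_integral[OF d] Yd ennreal_leI)
      qed
    qed
    also have "\<dots> = ennreal (((1/2) ^ n)\<^sup>2)"
      by (simp add: Liminf_const)
    finally show ?thesis .
  qed
  have Fd: "square_integrable hist_measure (\<lambda>x. F x - f n x)" for n
    unfolding square_integrable_def
  proof
    have "(\<integral>\<^sup>+x. ennreal (norm ((norm (F x - f n x))\<^sup>2)) \<partial>hist_measure) < \<infinity>"
      using bd[of n] by (simp add: le_less_trans)
    then show "integrable hist_measure (\<lambda>x. (norm (F x - f n x))\<^sup>2)"
      by (intro integrableI_bounded) measurable
  qed measurable
  have F: "square_integrable hist_measure F"
    using square_integrable_add[OF Fd[of 0] f(1)[of 0]] by simp
  have "norm (Y n - abs_L2_hist F) \<le> (1/2) ^ n" for n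
    using L2_hist_norm_le[OF Fd bd[of n]]
    by (simp add: f(2) norm_minus_commute[of "abs_L2_hist (f n)"] L2_hist_abs_diff[OF F f(1)])
  then have "(\<lambda>n. Y n - abs_L2_hist F) \<longlonglongrightarrow> 0"
    by (intro Lim_null_comparison[OF always_eventually LIMSEQ_realpow_zero[of "1/2"]]) auto
  then show ?thesis
    by (auto simp: convergent_def dest: LIM_zero_cancel)
qed

instance L2_hist :: (euclidean_space) banach
proof
  fix X :: "nat \<Rightarrow> 'a L2_hist"
  assume X: "Cauchy X"
  have "\<forall>k. \<exists>N. \<forall>m\<ge>N. \<forall>n\<ge>N. norm (X m - X n) < (1/2) ^ k"
    using X by (auto simp: Cauchy_def dist_norm)
  then obtain N where N: "\<And>k m n. m \<ge> N k \<Longrightarrow> n \<ge> N k \<Longrightarrow> norm (X m - X n) < (1/2) ^ k"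
    by metis
  define r where "r k = k + (\<Sum>i\<le>k. N i)" for k
  have r: "strict_mono r" "N k \<le> r k" for k
  proof -
    show "strict_mono r" by (rule strict_monoI_Suc) (simp add: r_def)
    have "N k \<le> (\<Sum>i\<le>k. N i)" by (rule member_le_sum) auto
    then show "N k \<le> r k" by (simp add: r_def)
  qed
  have "convergent (X \<circ> r)"
  proof (rule L2_hist_fast_Cauchy)
    fix m n :: nat assume "n \<le> m"
    then have "r n \<le> r m" using r(1) by (simp add: strict_mono_less_eq)
    then show "norm ((X \<circ> r) m - (X \<circ> r) n) \<le> (1/2) ^ n"
      using N[of n "r m" "r n"] r(2)[of n] by (simp add: less_imp_le)
  qed
  then obtain l where "(X \<circ> r) \<longlonglongrightarrow> l"
    by (auto simp: convergent_def)
  from Cauchy_converges_subseq[OF X r(1) this] show "convergent X"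
    by (rule convergentI)
qed

lemma L2_hist_bounded:
  fixes f :: "real \<Rightarrow> 'a::euclidean_space"
  assumes "f \<in> borel_measurable hist_measure" "\<And>x. norm (f x) \<le> C"
  shows "square_integrable hist_measure f"
proof -
  have "integrable hist_measure (\<lambda>x. C\<^sup>2)"
    by (simp add: integrable_restrict_UNIV)
  then have "integrable hist_measure (\<lambda>x. (norm (f x))\<^sup>2)"
  proof (rule Bochner_Integration.integrable_bound)
    show "(\<lambda>x. (norm (f x))\<^sup>2) \<in> borel_measurable hist_measure"
      using assms(1) by measurable
    show "AE x in hist_measure. norm ((norm (f x))\<^sup>2) \<le> norm (C\<^sup>2)"
      using assms(2) by (simp add: power_mono)
  qed
  with assms(1) show ?thesis by (simp add: square_integrable_def)
qed

lemma borel_imp_hist_measurable: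
  "f \<in> borel_measurable borel \<Longrightarrow> f \<in> borel_measurable hist_measure"
  by (intro measurable_restrict_space1 measurable_completion) simp

definition step_hist :: "nat \<Rightarrow> int \<Rightarrow> 'a \<Rightarrow> 'a::euclidean_space L2_hist" where
  "step_hist n k v = abs_L2_hist (\<lambda>x. if \<lfloor>of_nat n * x\<rfloor> = k then v else 0)"

lemma step_hist_square_integrable:
  "square_integrable hist_measure (\<lambda>x::real. if \<lfloor>of_nat n * x\<rfloor> = k then v else (0::'a::euclidean_space))"
proof (rule L2_hist_bounded)
  show "(\<lambda>x::real. if \<lfloor>of_nat n * x\<rfloor> = k then v else 0) \<in> borel_measurable hist_measure"
    by (rule borel_imp_hist_measurable) measurable
qed (auto intro: norm_ge_zero)

lemma L2_hist_abs_sum: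
  assumes "finite I" "\<And>i. i \<in> I \<Longrightarrow> square_integrable hist_measure (f i)"
  shows "abs_L2_hist (\<lambda>x. \<Sum>i\<in>I. f i x) = (\<Sum>i\<in>I. abs_L2_hist (f i)) \<and>
    square_integrable hist_measure (\<lambda>x. \<Sum>i\<in>I. f i x)"
  using assms
proof (induction I rule: finite_induct)
  case empty
  then show ?case by (simp add: zero_L2_hist_def)
next
  case (insert i I)
  then show ?case
    by (simp add: L2_hist_abs_add[symmetric] square_integrable_add)
qed

lemma step_hist_in_span:
  fixes v :: "'a::euclidean_space"
  shows "step_hist n k v \<in> span {step_hist n k b |n k b. b \<in> (Basis :: 'a set)}"
proof -
  have "step_hist n k v = (\<Sum>b\<in>Basis. (v \<bullet> b) *\<^sub>R step_hist n k b)"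
  proof -
    have "(\<Sum>b\<in>Basis. (v \<bullet> b) *\<^sub>R step_hist n k b) =
        (\<Sum>b\<in>Basis. abs_L2_hist (\<lambda>x. (v \<bullet> b) *\<^sub>R (if \<lfloor>of_nat n * x\<rfloor> = k then b else 0)))"
      unfolding step_hist_def
      by (intro sum.cong refl L2_hist_abs_scaleR step_hist_square_integrable)
    also have "\<dots> = abs_L2_hist (\<lambda>x. \<Sum>b\<in>Basis. (v \<bullet> b) *\<^sub>R (if \<lfloor>of_nat n * x\<rfloor> = k then b else 0))"
      by (rule conjunct1[OF L2_hist_abs_sum, symmetric])
        (auto intro: square_integrable_scaleR step_hist_square_integrable)
    also have "(\<lambda>x::real. \<Sum>b\<in>Basis. (v \<bullet> b) *\<^sub>R (if \<lfloor>of_nat n * x\<rfloor> = k then b else 0))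
        = (\<lambda>x. if \<lfloor>of_nat n * x\<rfloor> = k then v else 0)"
      by (rule ext) (simp add: euclidean_representation)
    finally show ?thesis by (simp add: step_hist_def)
  qed
  also have "\<dots> \<in> span {step_hist n k b |n k b. b \<in> (Basis :: 'a set)}"
    by (intro span_sum span_scale span_base) auto
  finally show ?thesis .
qed

lemma L2_hist_span_dense:
  "closure (span {step_hist n k b |n k b. b \<in> (Basis :: 'a::euclidean_space set)}) = UNIV"
    (is "closure ?S = UNIV")
proof -
  define C where "C = closure ?S"
  have lim: "abs_L2_hist f \<in> C" if "(\<lambda>n. abs_L2_hist (g n)) \<longlonglongrightarrow> abs_L2_hist f"
    "\<And>n. abs_L2_hist (g n) \<in> C" for f and g :: "nat \<Rightarrow> real \<Rightarrow> 'a"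
    using that unfolding C_def by (meson closed_closure closed_sequentially)
  have cont: "abs_L2_hist g \<in> C"
    if g: "continuous_on UNIV g" "\<And>x. norm (g x) \<le> B" for g :: "real \<Rightarrow> 'a" and B
  proof (rule lim)
    define s where "s n x = (\<Sum>k\<in>{- int (Suc n)..0}. if \<lfloor>of_nat (Suc n) * x\<rfloor> = k then g (of_int k / of_nat (Suc n)) else 0)"
      for n and x :: real
    have s_eq: "abs_L2_hist (s n) = (\<Sum>k\<in>{- int (Suc n)..0}. step_hist (Suc n) k (g (of_int k / of_nat (Suc n))))" for n
      unfolding s_def step_hist_def
      by (rule conjunct1[OF L2_hist_abs_sum])
        (rule finite_atLeastAtMost_int, rule step_hist_square_integrable)
    show "abs_L2_hist (s n) \<in> C" for n
      unfolding s_eq C_def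
      by (rule subsetD[OF closure_subset]) (intro span_sum step_hist_in_span)
    have s_sq: "square_integrable hist_measure (s n)" for n
      unfolding s_def
      by (rule conjunct2[OF L2_hist_abs_sum])
        (rule finite_atLeastAtMost_int, rule step_hist_square_integrable)
    have s_val: "s n x = (if \<lfloor>of_nat (Suc n) * x\<rfloor> \<in> {- int (Suc n)..0}
        then g (of_int \<lfloor>of_nat (Suc n) * x\<rfloor> / of_nat (Suc n)) else 0)" for n x
      unfolding s_def by (subst sum.delta') auto
    have B: "0 \<le> B" using g(2)[of 0] norm_ge_zero[of "g 0"] by linarith
    show "(\<lambda>n. abs_L2_hist (s n)) \<longlonglongrightarrow> abs_L2_hist g"
    proof (rule L2_hist_dominated(2)[where h = "\<lambda>_. B"])
      show "square_integrable hist_measure g"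
        by (rule L2_hist_bounded[OF borel_imp_hist_measurable g(2)])
          (rule borel_measurable_continuous_onI[OF g(1)])
      show "square_integrable hist_measure (\<lambda>_. B)"
        by (rule L2_hist_bounded[of _ "\<bar>B\<bar>"]) auto
      show "s n \<in> borel_measurable hist_measure" for n
        using s_sq by (simp add: square_integrable_def)
      show "AE x in hist_measure. norm (s n x) \<le> norm B" for n
        using B g(2) by (auto simp: s_val)
      show "AE x in hist_measure. (\<lambda>n. s n x) \<longlonglongrightarrow> g x"
      proof (rule AE_I2)
        fix x assume "x \<in> space hist_measure"
        then have x: "-1 \<le> x" "x \<le> 0" by auto
        define y :: "nat \<Rightarrow> real"
          where "y n = of_int \<lfloor>of_nat (Suc n) * x\<rfloor> / of_nat (Suc n)" for n
        have "s n x = g (y n)" for n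
        proof -
          have "\<lfloor>of_nat (Suc n) * x\<rfloor> \<le> 0"
            using mult_nonneg_nonpos[OF of_nat_0_le_iff x(2), of "Suc n"]
            by (simp add: floor_le_iff del: of_nat_Suc)
          moreover have "- int (Suc n) \<le> \<lfloor>of_nat (Suc n) * x\<rfloor>"
            using mult_left_mono[OF x(1), of "of_nat (Suc n)"] by (simp add: le_floor_iff)
          ultimately show ?thesis by (simp add: s_val y_def)
        qed
        moreover have "y \<longlonglongrightarrow> x"
        proof (rule LIMSEQ_I)
          fix e :: real assume "0 < e"
          then obtain N where N: "inverse (of_nat (Suc N)) < e"
            using reals_Archimedean by blast
          have "norm (y n - x) < e" if "N \<le> n" for n
          proof -
            have "y n - x = - frac (of_nat (Suc n) * x) / of_nat (Suc n)"
              by (simp add: y_def frac_def field_simps del: of_nat_Suc)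
            then have "norm (y n - x) = frac (of_nat (Suc n) * x) * inverse (of_nat (Suc n))"
              by (simp add: divide_inverse abs_mult frac_ge_0 del: of_nat_Suc)
            also have "\<dots> \<le> 1 * inverse (of_nat (Suc n))"
              by (intro mult_right_mono less_imp_le[OF frac_lt_1]) simp
            also have "\<dots> \<le> inverse (of_nat (Suc N))"
              using that by (simp add: le_imp_inverse_le)
            finally show ?thesis using N by simp
          qed
          then show "\<exists>N. \<forall>n\<ge>N. norm (y n - x) < e" by blast
        qed
        then have "(\<lambda>n. g (y n)) \<longlonglongrightarrow> g x"
          using g(1) by (simp add: continuous_on_sequentially o_def)
        ultimately show "(\<lambda>n. s n x) \<longlonglongrightarrow> g x" by simp
      qed
    qed
  qed
  have bdd: "abs_L2_hist f \<in> C"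
    if f: "f \<in> borel_measurable hist_measure" "\<And>x. norm (f x) \<le> real B" for f :: "real \<Rightarrow> 'a" and B :: nat
  proof -
    have "f measurable_on {-1..0}"
      using f(1) by (subst measurable_on_iff_borel_measurable) auto
    then obtain N g where N: "negligible N" and g: "\<And>n. continuous_on UNIV (g n)"
      and gl: "\<And>x. x \<notin> N \<Longrightarrow> (\<lambda>n. g n x) \<longlonglongrightarrow> (if x \<in> {-1..0} then f x else 0)"
      unfolding measurable_on_def by blast
    define P where "P = closest_point (cball (0::'a) (real B))"
    have P_cont: "continuous_on UNIV P"
      unfolding P_def by (rule continuous_on_closest_point) auto
    have P_bd: "norm (P x) \<le> real B" for x
      using closest_point_in_set[of "cball (0::'a) (real B)" x] by (simp add: P_def)
    have P_id: "P x = x" if "norm x \<le> real B" for x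
      using that by (simp add: P_def closest_point_self)
    have Pg: "continuous_on UNIV (\<lambda>x. P (g n x))" for n
      by (rule continuous_on_compose2[OF P_cont g]) auto
    show ?thesis
    proof (rule lim)
      show "abs_L2_hist (\<lambda>x. P (g n x)) \<in> C" for n
        by (rule cont[OF Pg P_bd])
      show "(\<lambda>n. abs_L2_hist (\<lambda>x. P (g n x))) \<longlonglongrightarrow> abs_L2_hist f"
      proof (rule L2_hist_dominated(2)[where h = "\<lambda>_. real B"])
        show "square_integrable hist_measure f"
          by (rule L2_hist_bounded[OF f])
        show "square_integrable hist_measure (\<lambda>_. real B)"
          by (rule L2_hist_bounded[of _ "real B"]) auto
        show "(\<lambda>x. P (g n x)) \<in> borel_measurable hist_measure" for n
          by (rule borel_imp_hist_measurable[OF borel_measurable_continuous_onI[OF Pg]])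
        show "AE x in hist_measure. norm (P (g n x)) \<le> norm (real B)" for n
          using P_bd by simp
        have "AE x in lebesgue. x \<notin> N"
          using N by (simp add: negligible_iff_null_sets AE_not_in)
        then have "AE x in lebesgue. x \<in> {-1..0} \<longrightarrow> (\<lambda>n. P (g n x)) \<longlonglongrightarrow> f x"
        proof eventually_elim
          case (elim x)
          show ?case
          proof
            assume "x \<in> {-1..0}"
            with gl[OF elim] have "(\<lambda>n. g n x) \<longlonglongrightarrow> f x" by simp
            then have "(\<lambda>n. P (g n x)) \<longlonglongrightarrow> P (f x)"
              using P_cont by (simp add: continuous_on_sequentially o_def)
            then show "(\<lambda>n. P (g n x)) \<longlonglongrightarrow> f x"
              by (simp add: P_id[OF f(2)])
          qed
        qed
        then show "AE x in hist_measure. (\<lambda>n. P (g n x)) \<longlonglongrightarrow> f x"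
          by (subst AE_restrict_space_iff) auto
      qed
    qed
  qed
  have "x \<in> C" for x :: "'a L2_hist"
  proof -
    obtain f where f: "square_integrable hist_measure f" and x: "x = abs_L2_hist f"
      by (rule L2_hist_cases)
    have f_meas: "f \<in> borel_measurable hist_measure"
      using f by (simp add: square_integrable_def)
    define g where "g n x = (if norm (f x) \<le> real n then f x else 0)" for n x
    have g_meas: "g n \<in> borel_measurable hist_measure" for n
      unfolding g_def using f_meas by measurable
    show "x \<in> C"
      unfolding x
    proof (rule lim)
      show "abs_L2_hist (g n) \<in> C" for n
        by (rule bdd[OF g_meas, of n n]) (simp add: g_def)
      show "(\<lambda>n. abs_L2_hist (g n)) \<longlonglongrightarrow> abs_L2_hist f"
      proof (rule L2_hist_dominated(2)[OF f f g_meas])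
        show "AE x in hist_measure. norm (g n x) \<le> norm (f x)" for n
          by (simp add: g_def)
        have "(\<lambda>n. g n x) \<longlonglongrightarrow> f x" for x
        proof (rule tendsto_eventually)
          obtain N where "norm (f x) \<le> real N" using real_arch_simple by blast
          then show "\<forall>\<^sub>F n in sequentially. g n x = f x"
            by (intro eventually_sequentiallyI[of N]) (auto simp: g_def)
        qed
        then show "AE x in hist_measure. (\<lambda>n. g n x) \<longlonglongrightarrow> f x" by simp
      qed
    qed
  qed
  then show ?thesis by (auto simp: C_def)
qed

lemma countable_dense_of_span:
  fixes D :: "'a::real_normed_vector set"
  assumes "countable D" "closure (span D) = UNIV"
  shows "\<exists>Q::'a set. countable Q \<and> closure Q = UNIV"
proof -
  define Q where "Q = (\<lambda>xs. \<Sum>(q, d)\<leftarrow>xs. of_rat q *\<^sub>R d) ` lists ((UNIV::rat set) \<times> D)"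
  have "countable Q"
    unfolding Q_def using assms(1) by (intro countable_image countable_lists countable_SIGMA) auto
  have add: "a + b \<in> Q" if "a \<in> Q" "b \<in> Q" for a b
  proof -
    from that obtain xs ys where "xs \<in> lists (UNIV \<times> D)" "ys \<in> lists (UNIV \<times> D)"
      and ab: "a = (\<Sum>(q, d)\<leftarrow>xs. of_rat q *\<^sub>R d)" "b = (\<Sum>(q, d)\<leftarrow>ys. of_rat q *\<^sub>R d)"
      unfolding Q_def by blast
    then have "xs @ ys \<in> lists (UNIV \<times> D)" by simp
    then show ?thesis unfolding Q_def ab by (intro image_eqI[where x = "xs @ ys"]) simp_all
  qed
  have base: "of_rat q *\<^sub>R d \<in> Q" if "d \<in> D" for q d
    unfolding Q_def using that by (intro image_eqI[where x = "[(q, d)]"]) simp_all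
  have zero: "0 \<in> Q"
    unfolding Q_def by (intro image_eqI[where x = "[]"]) simp_all
  have "span D \<subseteq> closure Q"
  proof
    fix x assume "x \<in> span D"
    then show "x \<in> closure Q"
    proof (induction rule: span_induct_alt)
      case base
      then show ?case using zero closure_subset by blast
    next
      case (step c d y)
      from step(2) obtain Y where Y: "\<And>n. Y n \<in> Q" "Y \<longlonglongrightarrow> y"
        unfolding closure_sequential by blast
      have "\<exists>q. c < real_of_rat q \<and> real_of_rat q < c + inverse (real (Suc n))" for n
        by (rule of_rat_dense) simp
      then obtain q where q: "\<And>n. c < real_of_rat (q n)" "\<And>n. real_of_rat (q n) < c + inverse (real (Suc n))"
        by metis
      have "(\<lambda>n. real_of_rat (q n)) \<longlonglongrightarrow> c"
      proof (rule tendsto_sandwich[where f = "\<lambda>_. c" and h = "\<lambda>n. c + inverse (real (Suc n))"])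
        show "(\<lambda>n. c + inverse (real (Suc n))) \<longlonglongrightarrow> c"
          using LIMSEQ_inverse_real_of_nat_add by simp
        show "(\<lambda>n. c) \<longlonglongrightarrow> c" by simp
        show "\<forall>\<^sub>F n in sequentially. c \<le> real_of_rat (q n)"
          by (rule always_eventually) (auto intro: less_imp_le q)
        show "\<forall>\<^sub>F n in sequentially. real_of_rat (q n) \<le> c + inverse (real (Suc n))"
          by (rule always_eventually) (blast intro: less_imp_le q)
      qed
      then have "(\<lambda>n. real_of_rat (q n) *\<^sub>R d + Y n) \<longlonglongrightarrow> c *\<^sub>R d + y"
        by (intro tendsto_intros Y(2))
      moreover have "real_of_rat (q n) *\<^sub>R d + Y n \<in> Q" for n
        by (intro add Y(1)) (rule \<open>\<And>q d. d \<in> D \<Longrightarrow> of_rat q *\<^sub>R d \<in> Q\<close>[OF step(1)])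
      ultimately show ?case
        unfolding closure_sequential
        by (intro exI[of _ "\<lambda>n. real_of_rat (q n) *\<^sub>R d + Y n"] conjI allI)
    qed
  qed
  then have "closure (span D) \<subseteq> closure Q"
    by (simp add: closure_minimal)
  with assms(2) \<open>countable Q\<close> show ?thesis by auto
qed

lemma countable_basis_of_dense:
  fixes Q :: "'a::metric_space set"
  assumes "countable Q" "closure Q = UNIV"
  shows "\<exists>B::'a set set. countable B \<and> topological_basis B"
proof -
  define B where "B = (\<lambda>(q, n). ball q (inverse (real (Suc n)))) ` (Q \<times> UNIV)"
  have "countable B"
    unfolding B_def using assms(1) by (intro countable_image countable_SIGMA) auto
  moreover have "topological_basis B"
  proof (rule topological_basisI)
    show "open b" if "b \<in> B" for b using that by (auto simp: B_def)
    fix U :: "'a set" and x assume U: "open U" "x \<in> U"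
    then obtain e where e: "e > 0" "ball x e \<subseteq> U" by (rule openE)
    then obtain n where n: "inverse (real (Suc n)) < e / 2"
      using reals_Archimedean[of "e / 2"] by auto
    have "x \<in> closure Q" using assms(2) by simp
    moreover have "0 < inverse (real (Suc n))" by simp
    ultimately obtain q where q: "q \<in> Q" "dist q x < inverse (real (Suc n))"
      unfolding closure_approachable by blast
    have "ball q (inverse (real (Suc n))) \<subseteq> ball x e"
    proof
      fix z assume "z \<in> ball q (inverse (real (Suc n)))"
      then have "dist q z < inverse (real (Suc n))" by simp
      then have "dist x z < e"
        using n q(2) dist_triangle[of x z q] by (simp add: dist_commute)
      then show "z \<in> ball x e" by simp
    qed
    with e q show "\<exists>b\<in>B. x \<in> b \<and> b \<subseteq> U"
      unfolding B_def by (intro bexI[of _ "ball q (inverse (real (Suc n)))"]) auto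
  qed
  ultimately show ?thesis by blast
qed

instance L2_hist :: (euclidean_space) second_countable_topology
proof
  have eq: "{step_hist n k b |n k b. b \<in> (Basis :: 'a set)}
      = (\<lambda>(n, k, b). step_hist n k b) ` (UNIV \<times> UNIV \<times> Basis)"
    by force
  have "countable {step_hist n k b |n k b. b \<in> (Basis :: 'a set)}"
    unfolding eq by (intro countable_image countable_SIGMA) (auto intro: countable_finite)
  from countable_dense_of_span[OF this L2_hist_span_dense]
  obtain Q :: "'a L2_hist set" where "countable Q" "closure Q = UNIV" by blast
  from countable_basis_of_dense[OF this]
  show "\<exists>B :: 'a L2_hist set set. countable B \<and> open = generate_topology B"
    using topological_basis_imp_subbasis by blast
qed

text \<open>The state space \<open>M\<^sub>2\<close>; the library norm on a product is the Hilbert norm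
  \<open>sqrt (norm v ^ 2 + norm \<phi> ^ 2)\<close>.\<close>
type_synonym 'n M2 = "(real ^ 'n) \<times> (real ^ 'n) L2_hist"

text \<open>\<open>H1_hist g g'\<close>: on \<open>[-1, 0]\<close> the function \<open>g\<close> is the absolutely continuous representative
  of an element of \<open>H\<^sup>1(-1,0)\<close>, and \<open>g'\<close> represents its derivative. In particular \<open>g\<close> is continuous
  on \<open>[-1, 0]\<close>, and \<open>g 0\<close> and \<open>g (-1)\<close> are the boundary values (traces).\<close>
definition H1_hist :: "(real \<Rightarrow> 'a::euclidean_space) \<Rightarrow> (real \<Rightarrow> 'a) \<Rightarrow> bool" where
  "H1_hist g g' \<longleftrightarrow> square_integrable hist_measure g' \<and>
     (\<forall>\<theta>\<in>{-1..0}. g \<theta> = g (-1) + (LINT s|lebesgue_on {-1..\<theta>}. g' s))"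

text \<open>The unbounded operator \<open>\<A>\<close>, given by its graph; its domain is the projection of the graph
  to the first component.\<close>
definition neutral_operator ::
  "real ^ 'n ^ 'n \<Rightarrow> (real \<Rightarrow> real ^ 'n ^ 'n) \<Rightarrow> (real \<Rightarrow> real ^ 'n ^ 'n) \<Rightarrow> ('n M2 \<times> 'n M2) set"
where
  "neutral_operator Am1 A2 A3 =
     {((\<phi> 0 - Am1 *v \<phi> (-1), abs_L2_hist \<phi>),
       (LINT \<theta>|hist_measure. A2 \<theta> *v \<phi>' \<theta> + A3 \<theta> *v \<phi> \<theta>, abs_L2_hist \<phi>')) | \<phi> \<phi>'. H1_hist \<phi> \<phi>'}"

definition control_operator :: "real ^ 'm ^ 'n \<Rightarrow> real ^ 'm \<Rightarrow> 'n M2" where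
  "control_operator B u = (B *v u, 0)"

text \<open>A semigroup is a total function of time here; only its values at \<open>t \<ge> 0\<close> are meaningful.\<close>
definition C0_semigroup :: "(real \<Rightarrow> 'a::banach \<Rightarrow> 'a) \<Rightarrow> bool" where
  "C0_semigroup S \<longleftrightarrow>
     (\<forall>t\<ge>0. bounded_linear (S t)) \<and>
     (\<forall>x. S 0 x = x) \<and>
     (\<forall>s\<ge>0. \<forall>t\<ge>0. \<forall>x. S (s + t) x = S s (S t x)) \<and>
     (\<forall>x. ((\<lambda>t. S t x) \<longlongrightarrow> x) (at_right 0))"

definition infinitesimal_generator :: "(real \<Rightarrow> 'a::banach \<Rightarrow> 'a) \<Rightarrow> ('a \<times> 'a) set" where
  "infinitesimal_generator S = {(x, y). ((\<lambda>t. (S t x - x) /\<^sub>R t) \<longlongrightarrow> y) (at_right 0)}"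

text \<open>\<open>generates_C0_semigroup \<A> S\<close> says that \<open>S t\<close> is \<open>e\<^sup>\<A>\<^sup>t\<close>; a \<open>C\<^sub>0\<close>-semigroup is determined on
  \<open>t \<ge> 0\<close> by its generator.\<close>
definition generates_C0_semigroup ::
  "('a::banach \<times> 'a) set \<Rightarrow> (real \<Rightarrow> 'a \<Rightarrow> 'a) \<Rightarrow> bool" where
  "generates_C0_semigroup \<A> S \<longleftrightarrow> C0_semigroup S \<and> infinitesimal_generator S = \<A>"

text \<open>The integral is the Bochner integral in the state space.\<close>
definition exactly_null_controllable ::
  "(real \<Rightarrow> 'a::{banach, second_countable_topology} \<Rightarrow> 'a) \<Rightarrow> ('u::euclidean_space \<Rightarrow> 'a) \<Rightarrow> bool"
where
  "exactly_null_controllable S \<B> \<longleftrightarrow>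
     (\<exists>T>0. \<forall>x0. \<exists>u. square_integrable (lebesgue_on {0..T}) u \<and>
        S T x0 + (LINT \<tau>|lebesgue_on {0..T}. S (T - \<tau>) (\<B> (u \<tau>))) = 0)"

definition char_matrix ::
  "real ^ 'n ^ 'n \<Rightarrow> (real \<Rightarrow> real ^ 'n ^ 'n) \<Rightarrow> (real \<Rightarrow> real ^ 'n ^ 'n) \<Rightarrow> complex \<Rightarrow> complex ^ 'n ^ 'n"
where
  "char_matrix Am1 A2 A3 z =
     (\<chi> i j. mat z $ i $ j - z * exp (- z) * of_real (Am1 $ i $ j)
       - (LINT s|hist_measure. z * exp (z * of_real s) * of_real (A2 s $ i $ j)
            + exp (z * of_real s) * of_real (A3 s $ i $ j)))"

definition complex_matrix :: "real ^ 'm ^ 'n \<Rightarrow> complex ^ 'm ^ 'n" where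
  "complex_matrix M = (\<chi> i j. of_real (M $ i $ j))"

definition append_columns :: "'a ^ 'm ^ 'n \<Rightarrow> 'a ^ 'k ^ 'n \<Rightarrow> 'a ^ ('m + 'k) ^ 'n" where
  "append_columns M N = (\<chi> i j. case j of Inl l \<Rightarrow> M $ i $ l | Inr l \<Rightarrow> N $ i $ l)"

end

theory Submission
  imports Defs
begin

text \<open>
  Both conditions come from bounded functionals \<open>f\<close> on the state space that satisfy
  \<open>f (\<A> x) = z * f x + l x\<close> on the domain of \<open>\<A>\<close>, with \<open>l\<close> bounded; along an orbit such an \<open>f\<close>
  obeys a scalar linear differential equation.

  A left null vector \<open>w\<close> of the characteristic matrix at \<open>z\<close> which annihilates \<open>B\<close> yields an \<open>f \<noteq> 0\<close>
  with \<open>l = 0\<close> that the control does not influence, so no state with \<open>f x \<noteq> 0\<close> can be steered to zero.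

  For the second condition \<open>B\<close> plays no role: on all of \<open>M\<^sub>2\<close> exact null controllability already
  excludes every eigenvalue \<open>\<mu> \<noteq> 0\<close> of the delay matrix. If \<open>w\<close> is a left eigenvector, then for every
  \<open>z\<close> with \<open>exp z = \<mu>\<close> the functional \<open>f (v, \<phi>) = \<integral> exp (- z * s) * (w \<bullet> \<phi> s)\<close> satisfies the equation
  above with \<open>l (v, \<phi>) = w \<bullet> v\<close>, and \<open>v\<close> stays bounded along a controlled trajectory. Hence pairing the
  initial history \<open>w \<bullet> \<phi>\<close> with a combination \<open>g\<close> of these exponentials costs at most a constant times the
  \<open>L\<^sub>1\<close> norm of \<open>g\<close>. Taking for \<open>g\<close> powers of \<open>sin\<^sup>2\<close> times one exponential, which concentrate at a
  point, and an unbounded square-integrable history contradicts this.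
\<close>

unbundle no fps_syntax

section \<open>Strongly continuous semigroups\<close>

text \<open>Banach-Steinhaus by Baire category: the closed sets \<open>E k\<close> cover the space,
  so one of them contains a ball, and the bound on this ball transfers to all vectors by
  scaling.\<close>

lemma uniform_boundedness:
  fixes T :: "'i \<Rightarrow> 'a::banach \<Rightarrow> 'b::real_normed_vector"
  assumes lin: "\<And>i. i \<in> I \<Longrightarrow> bounded_linear (T i)"
    and bd: "\<And>x. \<exists>K. \<forall>i\<in>I. norm (T i x) \<le> K"
  shows "\<exists>M. \<forall>i\<in>I. \<forall>x. norm (T i x) \<le> M * norm x"
proof -
  define E where "E k = {x. \<forall>i\<in>I. norm (T i x) \<le> real k}" for k :: nat
  have cl: "closed (E k)" for k
  proof -
    have "E k = (\<Inter>i\<in>I. {x. norm (T i x) \<le> real k})"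
      by (auto simp: E_def)
    moreover have "closed {x. norm (T i x) \<le> real k}" if "i \<in> I" for i
      by (intro closed_Collect_le continuous_intros linear_continuous_on lin that)
    ultimately show ?thesis by auto
  qed
  have un: "(\<Union>k. E k) = UNIV"
  proof -
    have "\<exists>k. x \<in> E k" for x
    proof -
      obtain K where K: "\<forall>i\<in>I. norm (T i x) \<le> K" using bd by blast
      obtain k where "K \<le> real k" using real_arch_simple by blast
      with K have "x \<in> E k" by (force simp: E_def)
      then show ?thesis ..
    qed
    then show ?thesis by auto
  qed
  have "\<exists>k. interior (E k) \<noteq> {}"
  proof (rule ccontr)
    assume "\<nexists>k. interior (E k) \<noteq> {}"
    then have "Met_TC.mtopology interior_of (\<Union>(range E)) = {}"
      by (intro Met_TC.metric_Baire_category_alt) (auto simp: complete_UNIV cl)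
    with un show False by simp
  qed
  then obtain k x0 where "x0 \<in> interior (E k)" by blast
  then obtain r where r: "r > 0" "ball x0 r \<subseteq> E k"
    by (auto simp: mem_interior)
  have "norm (T i x) \<le> (4 * real k / r) * norm x" if i: "i \<in> I" for i x
  proof (cases "x = 0")
    case True
    then show ?thesis using linear_0[OF bounded_linear.linear[OF lin[OF i]]] by simp
  next
    case False
    interpret bounded_linear "T i" by (rule lin[OF i])
    \<comment> \<open>This brings \<open>x\<close> to length \<open>r / 2\<close>, so
      \<open>x0 + c *\<^sub>R x\<close> stays in the open ball and the image of
      \<open>c *\<^sub>R x\<close> is a difference of two values of norm at most
      \<open>k\<close>.\<close>
    define c where "c = r / (2 * norm x)"
    have c: "c > 0" using False r by (simp add: c_def)
    have "x0 + c *\<^sub>R x \<in> ball x0 r"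
      using False r by (simp add: dist_norm c_def)
    then have 1: "norm (T i (x0 + c *\<^sub>R x)) \<le> real k" using r i by (auto simp: E_def)
    have 2: "norm (T i x0) \<le> real k" using subsetD[OF r(2), of x0] r(1) i by (simp add: E_def)
    have "c * norm (T i x) = norm (T i (x0 + c *\<^sub>R x) - T i x0)"
      using c by (simp add: add scaleR)
    also have "\<dots> \<le> 2 * real k"
      using 1 2 norm_triangle_ineq4[of "T i (x0 + c *\<^sub>R x)" "T i x0"] by linarith
    finally have "norm (T i x) \<le> 2 * real k / c" using c by (simp add: field_simps)
    also have "\<dots> = (4 * real k / r) * norm x" using False r by (simp add: c_def field_simps)
    finally show ?thesis .
  qed
  then show ?thesis by blast
qed

lemma has_vector_derivative_exp_of_real:
  "((\<lambda>t. exp (c * complex_of_real t)) has_vector_derivative c * exp (c * of_real t)) (at t within A)"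
  by (rule has_vector_derivative_real_field) (auto intro!: derivative_eq_intros)

section \<open>Orbits of a C0-semigroup and functionals along them\<close>

context
  fixes S :: "real \<Rightarrow> 'a::banach \<Rightarrow> 'a"
  assumes S: "C0_semigroup S"
begin

lemma C0_semigroup_bounded_linear: "0 \<le> t \<Longrightarrow> bounded_linear (S t)"
  using S by (simp add: C0_semigroup_def)

lemma C0_semigroup_zero: "S 0 x = x"
  using S by (simp add: C0_semigroup_def)

lemma C0_semigroup_add: "0 \<le> s \<Longrightarrow> 0 \<le> t \<Longrightarrow> S (s + t) x = S s (S t x)"
  using S by (simp add: C0_semigroup_def)

lemma C0_semigroup_continuous_zero: "continuous (at 0 within {0..}) (\<lambda>t. S t x)"
  using S by (simp add: C0_semigroup_def continuous_within at_within_Ici_at_right)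

text \<open>Otherwise some times \<open>t n\<close> tending to \<open>0\<close> violate the bound
  with constant \<open>Suc n\<close>. Strong continuity at \<open>0\<close> makes each sequence
  \<open>S (t n) x\<close> convergent, hence bounded, and uniform boundedness gives a contradiction.
  Asking for \<open>M \<ge> 1\<close> makes the powers of \<open>M\<close> monotone for the later
  iteration.\<close>

lemma C0_semigroup_locally_bounded:
  "\<exists>\<delta>>0. \<exists>M\<ge>1. \<forall>t\<in>{0..\<delta>}. \<forall>x. norm (S t x) \<le> M * norm x"
proof (rule ccontr)
  assume neg: "\<not> ?thesis"
  have "\<exists>t\<in>{0..inverse (real (Suc n))}. \<exists>x. \<not> norm (S t x) \<le> real (Suc n) * norm x" for n
  proof (rule ccontr)
    assume "\<not> ?thesis"
    moreover have "inverse (real (Suc n)) > 0" "real (Suc n) \<ge> 1" by auto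
    ultimately show False using neg by blast
  qed
  then obtain t where t: "\<And>n. t n \<in> {0..inverse (real (Suc n))}"
      "\<And>n. \<exists>x. \<not> norm (S (t n) x) \<le> real (Suc n) * norm x"
    by metis
  have t0: "t \<longlonglongrightarrow> 0"
  proof (rule tendsto_sandwich[where f = "\<lambda>_. 0"])
    show "(\<lambda>n. inverse (real (Suc n))) \<longlonglongrightarrow> 0" by (rule LIMSEQ_inverse_real_of_nat)
    show "\<forall>\<^sub>F n in sequentially. 0 \<le> t n" using t(1) by simp
    show "\<forall>\<^sub>F n in sequentially. t n \<le> inverse (real (Suc n))" using t(1) by (intro always_eventually) auto
  qed simp
  have "\<exists>K. \<forall>n\<in>UNIV. norm (S (t n) x) \<le> K" for x
  proof -
    have "(\<lambda>n. S (t n) x) \<longlonglongrightarrow> S 0 x"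
      using t(1) by (intro continuous_within_tendsto_compose'[OF C0_semigroup_continuous_zero _ t0]) auto
    then have "Bseq (\<lambda>n. S (t n) x)" by (intro convergent_imp_Bseq convergentI)
    then show ?thesis unfolding Bseq_def by auto
  qed
  moreover have "bounded_linear (S (t n))" for n
    using t(1)[of n] by (intro C0_semigroup_bounded_linear) auto
  ultimately obtain M where M: "\<And>n x. norm (S (t n) x) \<le> M * norm x"
    using uniform_boundedness[of UNIV "\<lambda>n. S (t n)"] by blast
  obtain n where "M \<le> real n" using real_arch_simple by blast
  then have "M \<le> real (Suc n)" by simp
  then have "norm (S (t n) x) \<le> real (Suc n) * norm x" for x
    using M[of n x] by (meson mult_right_mono norm_ge_zero order_trans)
  with t(2) show False by blast
qed

text \<open>The semigroup law splits off steps of length \<open>\<delta>\<close>, each costing one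
  factor \<open>M\<close>; so \<open>M ^ n\<close> serves up to time
  \<open>n * \<delta>\<close>.\<close>

lemma C0_semigroup_bounded: "\<exists>M>0. \<forall>t\<in>{0..b}. \<forall>x. norm (S t x) \<le> M * norm x"
proof -
  obtain \<delta> M where \<delta>: "\<delta> > 0" and M: "M \<ge> 1" "\<And>t x. t \<in> {0..\<delta>} \<Longrightarrow> norm (S t x) \<le> M * norm x"
    using C0_semigroup_locally_bounded by blast
  have step: "\<forall>t\<in>{0..real n * \<delta>}. \<forall>x. norm (S t x) \<le> M ^ n * norm x" for n
  proof (induction n)
    case 0
    then show ?case by (simp add: C0_semigroup_zero)
  next
    case (Suc n)
    show ?case
    proof (intro ballI allI)
      fix t x assume t: "t \<in> {0..real (Suc n) * \<delta>}"
      have M1: "M ^ n \<ge> 1" using M(1) by simp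
      show "norm (S t x) \<le> M ^ Suc n * norm x"
      proof (cases "t \<le> \<delta>")
        case True
        then have "norm (S t x) \<le> M * norm x" using t M(2) by auto
        also have "\<dots> \<le> M ^ Suc n * norm x"
          using M1 M(1) by (intro mult_right_mono) auto
        finally show ?thesis .
      next
        case False
        then have "S t x = S \<delta> (S (t - \<delta>) x)"
          using C0_semigroup_add[of \<delta> "t - \<delta>" x] \<delta> by simp
        then have "norm (S t x) \<le> M * norm (S (t - \<delta>) x)" using M(2)[of \<delta>] \<delta> by simp
        also have "\<dots> \<le> M * (M ^ n * norm x)"
          using t False M(1) Suc.IH by (intro mult_left_mono) (auto simp: algebra_simps)
        finally show ?thesis by (simp add: mult.assoc)
      qed
    qed
  qed
  obtain n where "b / \<delta> \<le> real n" using real_arch_simple by blast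
  then have "b \<le> real n * \<delta>" using \<delta> by (simp add: field_simps)
  then have "\<forall>t\<in>{0..b}. \<forall>x. norm (S t x) \<le> M ^ n * norm x" using step[of n] by auto
  moreover have "M ^ n > 0" using M(1) by simp
  ultimately show ?thesis by blast
qed

lemma C0_semigroup_continuous_on: "continuous_on {0..b} (\<lambda>t. S t x)"
proof -
  obtain M where M: "M > 0" "\<And>t x. t \<in> {0..b} \<Longrightarrow> norm (S t x) \<le> M * norm x"
    using C0_semigroup_bounded by blast
  \<comment> \<open>Factoring out the operator at the smaller time reduces continuity at
    \<open>s\<close>, from both sides, to right continuity at \<open>0\<close>.\<close>
  have *: "norm (S t x - S s x) \<le> M * norm (S \<bar>t - s\<bar> x - x)" if "s \<in> {0..b}" "t \<in> {0..b}" for s t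
    using that
  proof (induction s t rule: linorder_wlog)
    case (le s t)
    interpret bounded_linear "S s" using le by (intro C0_semigroup_bounded_linear) auto
    have "S t x = S s (S (t - s) x)"
      using C0_semigroup_add[of s "t - s" x] le by simp
    then have "S t x - S s x = S s (S (t - s) x - x)" by (simp add: diff)
    then show ?case using M(2)[of s "S (t - s) x - x"] le by simp
  next
    case (sym s t)
    then show ?case by (simp add: norm_minus_commute abs_minus_commute)
  qed
  show ?thesis
    unfolding continuous_on_def
  proof
    fix s assume s: "s \<in> {0..b}"
    have "((\<lambda>t. \<bar>t - s\<bar>) \<longlongrightarrow> \<bar>s - s\<bar>) (at s within {0..b})" by (intro tendsto_intros)
    then have "((\<lambda>t. S \<bar>t - s\<bar> x) \<longlongrightarrow> S 0 x) (at s within {0..b})"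
      by (intro continuous_within_tendsto_compose'[OF C0_semigroup_continuous_zero]) auto
    then have "((\<lambda>t. M * norm (S \<bar>t - s\<bar> x - x)) \<longlongrightarrow> M * norm (S 0 x - x)) (at s within {0..b})"
      by (intro tendsto_intros)
    then have "((\<lambda>t. M * norm (S \<bar>t - s\<bar> x - x)) \<longlongrightarrow> 0) (at s within {0..b})"
      by (simp add: C0_semigroup_zero)
    moreover have "\<forall>\<^sub>F t in at s within {0..b}. norm (S t x - S s x) \<le> M * norm (S \<bar>t - s\<bar> x - x)"
      using * s by (auto simp: eventually_at_filter)
    ultimately have "((\<lambda>t. S t x - S s x) \<longlongrightarrow> 0) (at s within {0..b})"
      by (rule Lim_null_comparison[rotated])
    then show "((\<lambda>t. S t x) \<longlongrightarrow> S s x) (at s within {0..b})"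
      by (rule LIM_zero_cancel)
  qed
qed

text \<open>Integrated orbits lie in the domain of the generator whatever the state
  \<open>x\<close>. Identities that hold only on the domain thus become usable along arbitrary
  orbits.\<close>

lemma C0_semigroup_orbit_integral:
  assumes t: "0 \<le> t"
  shows "(integral {0..t} (\<lambda>s. S s x), S t x - x) \<in> infinitesimal_generator S"
proof -
  define C where "C = (\<lambda>s. S s x)"
  define F where "F u = integral {0..u} C" for u
  have cont: "continuous_on {0..b} C" for b
    unfolding C_def by (rule C0_semigroup_continuous_on)
  have int: "C integrable_on {a..b}" if "0 \<le> a" for a b
    using continuous_on_subset[OF cont[of b], of "{a..b}"] that
    by (intro integrable_continuous_real) auto
  have F0: "F 0 = 0" by (simp add: F_def)
  \<comment> \<open>\<open>S h\<close> moves the integration window to \<open>{h..t + h}\<close>, so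
    the difference quotient of the semigroup at \<open>F t\<close> is that of \<open>F\<close> at
    \<open>t\<close> minus that of \<open>F\<close> at \<open>0\<close>.\<close>
  have shift: "S h (F t) = F (t + h) - F h" if h: "0 \<le> h" for h
  proof -
    have "S h (F t) = integral {0..t} (S h \<circ> C)"
      unfolding F_def by (rule integral_linear[symmetric, OF int C0_semigroup_bounded_linear[OF h]]) simp
    also have "\<dots> = integral {0..t} (\<lambda>s. C (s + h))"
      using h by (intro integral_cong) (auto simp: C_def C0_semigroup_add[symmetric] add.commute)
    also have "\<dots> = integral {h..t + h} C"
      using integral_shift_real_ivl[of h h "t + h" C] by simp
    also have "\<dots> = F (t + h) - F h"
      using Henstock_Kurzweil_Integration.integral_combine[of 0 h "t + h" C] int[of 0 "t + h"] t h by (simp add: F_def algebra_simps)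
    finally show ?thesis .
  qed
  \<comment> \<open>The fundamental theorem is applied on \<open>{0..u + 1}\<close> to leave room on
    the right of \<open>u\<close>; only the right derivative enters the generator.\<close>
  have der: "((\<lambda>h. (F (u + h) - F u) /\<^sub>R h) \<longlongrightarrow> C u) (at_right 0)" if u: "0 \<le> u" for u
  proof -
    have "(F has_vector_derivative C u) (at u within {0..u + 1})"
      unfolding F_def using u by (intro integral_has_vector_derivative cont) auto
    then have "(F has_vector_derivative C u) (at u within {u..u + 1})"
      by (rule has_vector_derivative_within_subset) (use u in auto)
    then have "((\<lambda>y. norm (F y - F u - (y - u) *\<^sub>R C u) / norm (y - u)) \<longlongrightarrow> 0) (at_right u)"
      by (simp add: at_within_Icc_at_right has_vector_derivative_def has_derivative_iff_norm)
    then have "((\<lambda>h. norm (F (u + h) - F u - h *\<^sub>R C u) / norm h) \<longlongrightarrow> 0) (at_right 0)"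
      by (simp add: filterlim_at_right_to_0[of _ _ u] add.commute)
    moreover have "\<forall>\<^sub>F h in at_right 0. norm (F (u + h) - F u - h *\<^sub>R C u) / norm h
        = norm ((F (u + h) - F u) /\<^sub>R h - C u)"
      using eventually_at_right_less[of 0]
    proof eventually_elim
      case (elim h)
      then have "(F (u + h) - F u) /\<^sub>R h - C u = (F (u + h) - F u - h *\<^sub>R C u) /\<^sub>R h"
        by (simp add: scaleR_diff_right)
      then show ?case using elim by (simp add: divide_inverse_commute)
    qed
    ultimately have "((\<lambda>h. norm ((F (u + h) - F u) /\<^sub>R h - C u)) \<longlongrightarrow> 0) (at_right 0)"
      by (rule Lim_transform_eventually)
    then show ?thesis
      by (rule LIM_zero_cancel[OF tendsto_norm_zero_cancel])
  qed
  have "((\<lambda>h. (F (t + h) - F t) /\<^sub>R h - (F (0 + h) - F 0) /\<^sub>R h) \<longlongrightarrow> C t - C 0) (at_right 0)"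
    by (intro tendsto_diff der t order_refl)
  moreover have "\<forall>\<^sub>F h in at_right 0. (F (t + h) - F t) /\<^sub>R h - (F (0 + h) - F 0) /\<^sub>R h = (S h (F t) - F t) /\<^sub>R h"
    using eventually_at_right_less[of 0]
    by eventually_elim (simp add: shift F0 scaleR_diff_right)
  ultimately have "((\<lambda>h. (S h (F t) - F t) /\<^sub>R h) \<longlongrightarrow> C t - C 0) (at_right 0)"
    by (rule Lim_transform_eventually)
  then show ?thesis
    by (simp add: infinitesimal_generator_def F_def C_def C0_semigroup_zero)
qed

text \<open>Variation of constants: \<open>y t = f (S t x)\<close> solves
  \<open>y' = z * y + g\<close> with \<open>g t = l (S t x)\<close>, and multiplying by
  \<open>exp (- z * of_real t)\<close> turns this into an exact derivative.\<close>

lemma C0_semigroup_functional: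
  fixes f l :: "'a \<Rightarrow> complex"
  assumes f: "bounded_linear f" and l: "bounded_linear l"
    and eq: "\<And>x y. (x, y) \<in> infinitesimal_generator S \<Longrightarrow> f y = z * f x + l x"
    and b: "0 \<le> b"
  shows "f (S b x) = exp (z * of_real b) * (f x + integral {0..b} (\<lambda>s. exp (- z * of_real s) * l (S s x)))"
proof -
  define y where "y t = f (S t x)" for t
  define g where "g t = l (S t x)" for t
  have yc: "continuous_on {0..b} y"
    unfolding y_def by (intro bounded_linear.continuous_on[OF f] C0_semigroup_continuous_on)
  have gc: "continuous_on {0..b} g"
    unfolding g_def by (intro bounded_linear.continuous_on[OF l] C0_semigroup_continuous_on)
  have hc: "continuous_on {0..b} (\<lambda>s. z * y s + g s)"
    by (intro continuous_intros yc gc)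
  \<comment> \<open>The state \<open>x\<close> may lie outside the domain, so \<open>eq\<close> is
    applied to the orbit integral. This gives the integral form of the equation, and continuity of
    the integrand then makes \<open>y\<close> differentiable.\<close>
  have y_eq: "y t = f x + integral {0..t} (\<lambda>s. z * y s + g s)" if t: "t \<in> {0..b}" for t
  proof -
    have "f (S t x - x) = z * f (integral {0..t} (\<lambda>s. S s x)) + l (integral {0..t} (\<lambda>s. S s x))"
      using t by (intro eq C0_semigroup_orbit_integral) auto
    moreover have int: "(\<lambda>s. S s x) integrable_on {0..t}"
      by (intro integrable_continuous_real C0_semigroup_continuous_on)
    moreover have "f (integral {0..t} (\<lambda>s. S s x)) = integral {0..t} y"
      using integral_linear[OF int f] by (simp add: o_def y_def[abs_def])
    moreover have "l (integral {0..t} (\<lambda>s. S s x)) = integral {0..t} g"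
      using integral_linear[OF int l] by (simp add: o_def g_def[abs_def])
    moreover have "y integrable_on {0..t}" "g integrable_on {0..t}"
      using t by (auto intro!: integrable_continuous_real continuous_on_subset[OF yc] continuous_on_subset[OF gc])
    moreover have "integral {0..t} (\<lambda>s. z * y s + g s) = z * integral {0..t} y + integral {0..t} g"
      using \<open>y integrable_on {0..t}\<close> \<open>g integrable_on {0..t}\<close>
      by (subst Henstock_Kurzweil_Integration.integral_add) (auto intro: integrable_on_mult_right)
    ultimately show ?thesis
      using bounded_linear.linear[OF f] by (simp add: y_def linear_diff algebra_simps)
  qed
  have yd: "(y has_vector_derivative (z * y t + g t)) (at t within {0..b})" if t: "t \<in> {0..b}" for t
  proof -
    have "((\<lambda>t. f x + integral {0..t} (\<lambda>s. z * y s + g s)) has_vector_derivative (0 + (z * y t + g t))) (at t within {0..b})"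
      by (intro derivative_intros integral_has_vector_derivative hc t)
    then show ?thesis
      using y_eq t by (subst has_vector_derivative_cong_ev[where g = "\<lambda>t. f x + integral {0..t} (\<lambda>s. z * y s + g s)"])
        (auto simp: eventually_at_filter)
  qed
  have "((\<lambda>t. exp (- z * of_real t) * y t) has_vector_derivative exp (- z * of_real t) * g t) (at t within {0..b})"
    if t: "t \<in> {0..b}" for t
  proof -
    have "((\<lambda>t. exp (- z * of_real t) * y t) has_vector_derivative
        exp (- z * of_real t) * (z * y t + g t) + (- z * exp (- z * of_real t)) * y t) (at t within {0..b})"
      by (intro has_vector_derivative_mult has_vector_derivative_exp_of_real yd[OF t])
    then show ?thesis by (simp add: algebra_simps)
  qed
  then have "((\<lambda>t. exp (- z * of_real t) * g t) has_integral
      (exp (- z * of_real b) * y b - exp (- z * of_real 0) * y 0)) {0..b}"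
    by (intro fundamental_theorem_of_calculus b)
  then have "integral {0..b} (\<lambda>t. exp (- z * of_real t) * g t) = exp (- z * of_real b) * y b - f x"
    by (simp add: integral_unique y_def C0_semigroup_zero)
  then have "exp (z * of_real b) * (f x + integral {0..b} (\<lambda>t. exp (- z * of_real t) * g t))
      = (exp (z * of_real b) * exp (- z * of_real b)) * y b"
    by (simp add: algebra_simps)
  then show ?thesis
    by (simp add: y_def g_def exp_add[symmetric])
qed

end

section \<open>Absolutely continuous histories\<close>

text \<open>Fubini on the square: the integral of \<open>f x * g y\<close> is split along the
  diagonal, and each triangle becomes an iterated integral with an inner antiderivative.
  Integrability of the first product comes with the iterated integral.\<close>

lemma
  fixes f g :: "real \<Rightarrow> complex"
  assumes f: "integrable (lebesgue_on {a..b}) f" and g: "integrable (lebesgue_on {a..b}) g"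
  shows integrable_antiderivative_mult:
      "integrable (lebesgue_on {a..b}) (\<lambda>x. (LINT s|lebesgue_on {a..x}. f s) * g x)"
    and integral_mult_antiderivatives:
      "(LINT s|lebesgue_on {a..b}. f s) * (LINT s|lebesgue_on {a..b}. g s) =
        (LINT x|lebesgue_on {a..b}. (LINT s|lebesgue_on {a..x}. f s) * g x)
        + (LINT x|lebesgue_on {a..b}. f x * (LINT s|lebesgue_on {a..x}. g s))"
proof -
  define M where "M = lebesgue_on {a..b}"
  interpret M: finite_measure M
    unfolding M_def by (rule finite_measureI) (simp add: emeasure_restrict_space emeasure_lborel_Icc_eq)
  interpret P: pair_sigma_finite M M ..
  have f: "integrable M f" and g: "integrable M g"
    using f g by (simp_all add: M_def)
  have [measurable]: "f \<in> borel_measurable M" "g \<in> borel_measurable M"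
    using f g by auto
  have [measurable]: "(\<lambda>x. x) \<in> borel_measurable M"
    unfolding M_def by (intro measurable_restrict_space1 measurable_completion) simp
  have indef: "(LINT y|M. (if y \<le> x then h y else 0)) = (LINT y|lebesgue_on {a..x}. h y)"
    if "x \<in> space M" for x and h :: "real \<Rightarrow> complex"
  proof -
    have x: "x \<in> {a..b}" using that by (simp add: M_def)
    have "(LINT y|M. (if y \<le> x then h y else 0))
        = (LINT y|lebesgue. indicator {a..b} y *\<^sub>R (if y \<le> x then h y else 0))"
      unfolding M_def by (rule integral_restrict_space) simp
    also have "\<dots> = (LINT y|lebesgue. indicator {a..x} y *\<^sub>R h y)"
      using x by (intro Bochner_Integration.integral_cong) (auto simp: indicator_def)
    also have "\<dots> = (LINT y|lebesgue_on {a..x}. h y)"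
      by (rule integral_restrict_space[symmetric]) simp
    finally show ?thesis .
  qed
  have indef': "(LINT y|M. (if y < x then h y else 0)) = (LINT y|lebesgue_on {a..x}. h y)"
    if "x \<in> space M" "h \<in> borel_measurable M" for x and h :: "real \<Rightarrow> complex"
  proof -
    have [measurable]: "h \<in> borel_measurable M" by fact
    have "AE y in lebesgue. y \<noteq> x"
      by (rule AE_completion) (rule AE_lborel_singleton)
    then have "AE y in M. y \<noteq> x"
      unfolding M_def by (subst AE_restrict_space_iff) auto
    then have "(LINT y|M. (if y < x then h y else 0)) = (LINT y|M. (if y \<le> x then h y else 0))"
      by (intro integral_cong_AE) auto
    then show ?thesis using indef[OF that(1)] by simp
  qed
  \<comment> \<open>The diagonal is given to \<open>k1\<close> alone, so that the two kernels add up
    exactly; the strict inequality in \<open>k2\<close> is handled by \<open>indef'\<close>, since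
    one point is a null set.\<close>
  define k1 where "k1 = (\<lambda>(x, y). if x \<le> y then f x * g y else 0)"
  define k2 where "k2 = (\<lambda>(x, y). if y < x then f x * g y else 0)"
  have k: "integrable (M \<Otimes>\<^sub>M M) (\<lambda>(x, y). f x * g y)"
  proof (rule P.Fubini_integrable)
    show "integrable M (\<lambda>x. LINT y|M. norm (case (x, y) of (x, y) \<Rightarrow> f x * g y))"
      using f by (simp add: norm_mult)
    show "AE x in M. integrable M (\<lambda>y. case (x, y) of (x, y) \<Rightarrow> f x * g y)"
      using g by simp
  qed measurable
  have k1: "integrable (M \<Otimes>\<^sub>M M) k1" and k2: "integrable (M \<Otimes>\<^sub>M M) k2"
    by (rule Bochner_Integration.integrable_bound[OF k]; auto simp: k1_def k2_def)+
  have i1: "(LINT x|M. k1 (x, y)) = (LINT s|lebesgue_on {a..y}. f s) * g y" if "y \<in> space M" for y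
  proof -
    have "(LINT x|M. k1 (x, y)) = (LINT x|M. (if x \<le> y then f x else 0) * g y)"
      by (intro Bochner_Integration.integral_cong) (auto simp: k1_def)
    then show ?thesis using indef[OF that, of f] by simp
  qed
  have i2: "(LINT y|M. k2 (x, y)) = f x * (LINT s|lebesgue_on {a..x}. g s)" if "x \<in> space M" for x
  proof -
    have "(LINT y|M. k2 (x, y)) = (LINT y|M. f x * (if y < x then g y else 0))"
      by (intro Bochner_Integration.integral_cong) (auto simp: k2_def)
    then show ?thesis using indef'[OF that, of g] by simp
  qed
  have e1: "integrable M (\<lambda>y. LINT x|M. k1 (x, y))" "(LINT y|M. LINT x|M. k1 (x, y)) = integral\<^sup>L (M \<Otimes>\<^sub>M M) k1"
    using P.integrable_snd[of "\<lambda>x y. k1 (x, y)"] P.integral_snd[of "\<lambda>x y. k1 (x, y)"] k1 by simp_all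
  have e2: "(LINT x|M. LINT y|M. k2 (x, y)) = integral\<^sup>L (M \<Otimes>\<^sub>M M) k2"
    by (rule P.integral_fst'[OF k2])
  have "(LINT s|M. f s) * (LINT s|M. g s) = (LINT x|M. LINT y|M. f x * g y)"
    by simp
  also have "\<dots> = integral\<^sup>L (M \<Otimes>\<^sub>M M) (\<lambda>(x, y). f x * g y)"
    using P.integral_fst'[OF k] by simp
  also have "\<dots> = integral\<^sup>L (M \<Otimes>\<^sub>M M) (\<lambda>p. k1 p + k2 p)"
    by (intro Bochner_Integration.integral_cong) (auto simp: k1_def k2_def)
  also have "\<dots> = integral\<^sup>L (M \<Otimes>\<^sub>M M) k1 + integral\<^sup>L (M \<Otimes>\<^sub>M M) k2"
    by (rule Bochner_Integration.integral_add[OF k1 k2])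
  also have "\<dots> = (LINT y|M. LINT x|M. k1 (x, y)) + (LINT x|M. LINT y|M. k2 (x, y))"
    by (simp add: e1 e2)
  also have "\<dots> = (LINT x|M. (LINT s|lebesgue_on {a..x}. f s) * g x)
      + (LINT x|M. f x * (LINT s|lebesgue_on {a..x}. g s))"
    by (intro arg_cong2[where f = "(+)"] Bochner_Integration.integral_cong refl i1 i2)
  finally show "(LINT s|lebesgue_on {a..b}. f s) * (LINT s|lebesgue_on {a..b}. g s) =
        (LINT x|lebesgue_on {a..b}. (LINT s|lebesgue_on {a..x}. f s) * g x)
        + (LINT x|lebesgue_on {a..b}. f x * (LINT s|lebesgue_on {a..x}. g s))"
    by (simp add: M_def)
  show "integrable (lebesgue_on {a..b}) (\<lambda>x. (LINT s|lebesgue_on {a..x}. f s) * g x)"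
  proof -
    have "integrable M (\<lambda>y. LINT x|M. k1 (x, y)) \<longleftrightarrow>
        integrable M (\<lambda>x. (LINT s|lebesgue_on {a..x}. f s) * g x)"
      by (intro Bochner_Integration.integrable_cong refl i1)
    with e1(1) show ?thesis unfolding M_def by blast
  qed
qed

text \<open>Complex scalar counterpart of \<open>H1_hist\<close>, with the derivative only in L1.
  Integration by parts asks for no more, and the class is closed under products without L2
  estimates.\<close>

definition AC_hist :: "(real \<Rightarrow> complex) \<Rightarrow> (real \<Rightarrow> complex) \<Rightarrow> bool" where
  "AC_hist f f' \<longleftrightarrow> integrable hist_measure f' \<and>
     (\<forall>\<theta>\<in>{-1..0}. f \<theta> = f (-1) + (LINT s|lebesgue_on {-1..\<theta>}. f' s))"

lemma AC_hist_integrable: "AC_hist f f' \<Longrightarrow> integrable hist_measure f'"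
  unfolding AC_hist_def by (rule conjunct1)

text \<open>As a rewrite rule this equation loops, at \<open>\<theta> = -1\<close>.\<close>

lemma AC_histD:
  "AC_hist f f' \<Longrightarrow> \<theta> \<in> {-1..0} \<Longrightarrow> f \<theta> = f (-1) + (LINT s|lebesgue_on {-1..\<theta>}. f' s)"
  unfolding AC_hist_def by (drule conjunct2) (rule bspec)

lemma H1_histD:
  "H1_hist \<phi> \<phi>' \<Longrightarrow> \<theta> \<in> {-1..0} \<Longrightarrow> \<phi> \<theta> = \<phi> (-1) + (LINT s|lebesgue_on {-1..\<theta>}. \<phi>' s)"
  unfolding H1_hist_def by (drule conjunct2) (rule bspec)

lemma integrable_hist_subinterval:
  fixes f :: "real \<Rightarrow> 'a::euclidean_space"
  assumes "integrable hist_measure f" "\<theta> \<le> 0"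
  shows "integrable (lebesgue_on {-1..\<theta>}) f"
  using assms(2) by (intro integrable_subinterval[OF assms(1)]) auto

lemma AC_hist_mult_integrable:
  assumes f: "AC_hist f f'" and g: "integrable hist_measure g"
  shows "integrable hist_measure (\<lambda>s. f s * g s)"
proof -
  have "integrable hist_measure (\<lambda>s. f (-1) * g s + (LINT r|lebesgue_on {-1..s}. f' r) * g s)"
    using g integrable_antiderivative_mult[OF AC_hist_integrable[OF f] g]
    by (intro Bochner_Integration.integrable_add) auto
  moreover have "f s * g s = f (-1) * g s + (LINT r|lebesgue_on {-1..s}. f' r) * g s"
    if "s \<in> space hist_measure" for s
  proof -
    have "f s = f (-1) + (LINT r|lebesgue_on {-1..s}. f' r)"
      using that by (intro AC_histD[OF f]) simp
    then have "f s * g s = (f (-1) + (LINT r|lebesgue_on {-1..s}. f' r)) * g s"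
      by (rule arg_cong)
    then show ?thesis by (simp only: distrib_right)
  qed
  ultimately show ?thesis
    by (subst Bochner_Integration.integrable_cong[OF refl])
qed

text \<open>With both factors written as a value at \<open>-1\<close> plus an antiderivative, the
  only substantial term is the product of the two antiderivatives, which
  \<open>integral_mult_antiderivatives\<close> expands.\<close>

lemma AC_hist_mult:
  assumes f: "AC_hist f f'" and g: "AC_hist g g'"
  shows "AC_hist (\<lambda>s. f s * g s) (\<lambda>s. f' s * g s + f s * g' s)"
  unfolding AC_hist_def
proof (intro conjI ballI)
  have fi: "integrable hist_measure f'" and gi: "integrable hist_measure g'"
    by (rule AC_hist_integrable[OF f]) (rule AC_hist_integrable[OF g])
  show I: "integrable hist_measure (\<lambda>s. f' s * g s + f s * g' s)"
    using AC_hist_mult_integrable[OF g fi] AC_hist_mult_integrable[OF f gi]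
    by (simp add: mult.commute)
  fix \<theta> :: real assume \<theta>: "\<theta> \<in> {-1..0}"
  define M where "M = lebesgue_on {-1..\<theta>}"
  define F where "F s = (LINT r|lebesgue_on {-1..s}. f' r)" for s
  define G where "G s = (LINT r|lebesgue_on {-1..s}. g' r)" for s
  have fF: "f s = f (-1) + F s" and gG: "g s = g (-1) + G s" if "s \<in> {-1..0}" for s
    unfolding F_def G_def by (rule AC_histD[OF f that]) (rule AC_histD[OF g that])
  have fM: "integrable M f'" and gM: "integrable M g'"
    unfolding M_def using fi gi \<theta> by (auto intro: integrable_hist_subinterval)
  have FM: "integrable M (\<lambda>s. F s * g' s)" and GM: "integrable M (\<lambda>s. f' s * G s)"
    using integrable_antiderivative_mult[of "-1" \<theta> f' g'] integrable_antiderivative_mult[of "-1" \<theta> g' f'] fM gM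
    by (simp_all add: M_def F_def G_def mult.commute)
  have FG: "F \<theta> * G \<theta> = (LINT s|M. F s * g' s) + (LINT s|M. f' s * G s)"
    using integral_mult_antiderivatives[of "-1" \<theta> f' g'] fM gM
    by (simp add: M_def F_def G_def)
  have "f' s * g s + f s * g' s = (f' s * g (-1) + f' s * G s) + (f (-1) * g' s + F s * g' s)"
    if "s \<in> {-1..0}" for s
    unfolding fF[OF that] gG[OF that] by (simp add: algebra_simps)
  then have "(LINT s|M. f' s * g s + f s * g' s)
      = (LINT s|M. (f' s * g (-1) + f' s * G s) + (f (-1) * g' s + F s * g' s))"
    using \<theta> by (intro Bochner_Integration.integral_cong) (auto simp: M_def)
  also have "\<dots> = F \<theta> * g (-1) + (LINT s|M. f' s * G s) + (f (-1) * G \<theta> + (LINT s|M. F s * g' s))"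
    using fM gM FM GM by (simp add: F_def[of \<theta>] G_def[of \<theta>] M_def[symmetric])
  finally show "f \<theta> * g \<theta> = f (-1) * g (-1) + (LINT s|lebesgue_on {-1..\<theta>}. f' s * g s + f s * g' s)"
    unfolding fF[OF \<theta>] gG[OF \<theta>] using FG by (simp add: M_def[symmetric] algebra_simps)
qed

lemma AC_hist_ends:
  assumes "AC_hist f f'"
  shows "(LINT s|hist_measure. f' s) = f 0 - f (-1)"
proof -
  have "f 0 = f (-1) + (LINT s|hist_measure. f' s)"
    by (rule AC_histD[OF assms]) simp
  then show ?thesis by simp
qed

lemma AC_hist_antiderivative:
  assumes "integrable hist_measure g"
  shows "AC_hist (\<lambda>\<theta>. c + (LINT s|lebesgue_on {-1..\<theta>}. g s)) g"
proof -
  \<comment> \<open>At the left end the integral runs over a single point, so the function takes the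
    value \<open>c\<close> there.\<close>
  have "(LINT s|lebesgue_on {-1..-1::real}. g s) = 0"
    by (rule integral_eq_zero_null_sets) (simp add: null_sets_completionI)
  then show ?thesis
    using assms by (simp add: AC_hist_def)
qed

lemma AC_hist_exp: "AC_hist (\<lambda>s. exp (c * of_real s)) (\<lambda>s. c * exp (c * of_real s))"
  unfolding AC_hist_def
proof (intro conjI ballI)
  show int: "integrable hist_measure (\<lambda>s. c * exp (c * complex_of_real s))"
    by (intro continuous_imp_integrable_real continuous_intros)
  fix \<theta> :: real assume \<theta>: "\<theta> \<in> {-1..0}"
  have A: "((\<lambda>s. c * exp (c * complex_of_real s)) has_integral
      exp (c * of_real \<theta>) - exp (c * of_real (-1))) {-1..\<theta>}"
  proof (rule fundamental_theorem_of_calculus[where f = "\<lambda>s. exp (c * complex_of_real s)"])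
    show "-1 \<le> \<theta>" using \<theta> by simp
  qed (rule has_vector_derivative_exp_of_real)
  have B: "(LINT s|lebesgue_on {-1..\<theta>}. c * exp (c * complex_of_real s))
      = Henstock_Kurzweil_Integration.integral {-1..\<theta>} (\<lambda>s. c * exp (c * complex_of_real s))"
    using \<theta> integrable_hist_subinterval[OF int, of \<theta>] by (subst lebesgue_integral_eq_integral) simp_all
  show "exp (c * of_real \<theta>) = exp (c * complex_of_real (-1))
      + (LINT s|lebesgue_on {-1..\<theta>}. c * exp (c * complex_of_real s))"
    unfolding B integral_unique[OF A] by (metis add.commute diff_add_cancel)
qed

lemma square_integrable_hist_integrable:
  "square_integrable hist_measure f \<Longrightarrow> integrable hist_measure f"
  using L2_hist_integrable_norm[of f] by (simp add: square_integrable_def integrable_norm_iff)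

lemma H1_hist_AC_hist:
  fixes \<phi> :: "real \<Rightarrow> real ^ 'n"
  assumes "H1_hist \<phi> \<phi>'"
  shows "AC_hist (\<lambda>\<theta>. of_real (\<phi> \<theta> $ j)) (\<lambda>\<theta>. of_real (\<phi>' \<theta> $ j))"
  unfolding AC_hist_def
proof (intro conjI ballI)
  have sq: "square_integrable hist_measure \<phi>'" using assms unfolding H1_hist_def by (rule conjunct1)
  have int: "integrable hist_measure \<phi>'" by (rule square_integrable_hist_integrable[OF sq])
  then show "integrable hist_measure (\<lambda>\<theta>. complex_of_real (\<phi>' \<theta> $ j))"
    by (intro integrable_of_real integrable_bounded_linear[OF bounded_linear_vec_nth])
  fix \<theta> :: real assume \<theta>: "\<theta> \<in> {-1..0}"
  have "\<phi> \<theta> = \<phi> (-1) + (LINT s|lebesgue_on {-1..\<theta>}. \<phi>' s)"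
    by (rule H1_histD[OF assms \<theta>])
  moreover have "(LINT s|lebesgue_on {-1..\<theta>}. \<phi>' s) $ j = (LINT s|lebesgue_on {-1..\<theta>}. \<phi>' s $ j)"
    using integral_bounded_linear[OF bounded_linear_vec_nth integrable_hist_subinterval[OF int, of \<theta>]] \<theta> by simp
  ultimately show "complex_of_real (\<phi> \<theta> $ j) = of_real (\<phi> (-1) $ j)
      + (LINT s|lebesgue_on {-1..\<theta>}. complex_of_real (\<phi>' s $ j))"
    by simp
qed

section \<open>Square integrability of linear images, products and components\<close>

lemma square_integrable_bounded_linear:
  assumes h: "bounded_linear h" and f: "square_integrable M f"
  shows "square_integrable M (\<lambda>x. h (f x))"
proof -
  obtain K where K: "\<And>x. norm (h x) \<le> norm x * K"
    using bounded_linear.bounded[OF h] by blast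
  have m: "(\<lambda>x. h (f x)) \<in> borel_measurable M"
    by (rule measurable_compose[OF square_integrable_measurable[OF f]
          borel_measurable_continuous_onI[OF linear_continuous_on[OF h]]])
  moreover have "integrable M (\<lambda>x. (norm (h (f x)))\<^sup>2)"
  proof (rule Bochner_Integration.integrable_bound)
    show "integrable M (\<lambda>x. K\<^sup>2 * (norm (f x))\<^sup>2)"
      using f by (simp add: square_integrable_def)
    show "(\<lambda>x. (norm (h (f x)))\<^sup>2) \<in> borel_measurable M"
      using m by measurable
    have "(norm (h (f x)))\<^sup>2 \<le> K\<^sup>2 * (norm (f x))\<^sup>2" for x
      using power_mono[OF K[of "f x"], of 2] by (simp add: power_mult_distrib mult.commute)
    then show "AE x in M. norm ((norm (h (f x)))\<^sup>2) \<le> norm (K\<^sup>2 * (norm (f x))\<^sup>2)"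
      by simp
  qed
  ultimately show ?thesis by (simp add: square_integrable_def)
qed

lemma square_integrable_sum:
  assumes "\<And>i. i \<in> I \<Longrightarrow> square_integrable M (f i)"
  shows "square_integrable M (\<lambda>x. \<Sum>i\<in>I. f i x)"
  using assms by (induction I rule: infinite_finite_induct) (auto intro: square_integrable_add)

lemma square_integrable_mult_integrable:
  fixes f g :: "'a \<Rightarrow> complex"
  assumes f: "square_integrable M f" and g: "square_integrable M g"
  shows "integrable M (\<lambda>x. f x * g x)"
proof (rule Bochner_Integration.integrable_bound)
  show "integrable M (\<lambda>x. (norm (f x))\<^sup>2 + (norm (g x))\<^sup>2)"
    using assms by (simp add: square_integrable_def)
  show "(\<lambda>x. f x * g x) \<in> borel_measurable M"
    by (intro borel_measurable_times square_integrable_measurable assms)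
  have "norm (f x * g x) \<le> (norm (f x))\<^sup>2 + (norm (g x))\<^sup>2" for x
    using sum_squares_bound[of "norm (f x)" "norm (g x)"]
      mult_nonneg_nonneg[OF norm_ge_zero norm_ge_zero, of "f x" "g x"] unfolding norm_mult by linarith
  then show "AE x in M. norm (f x * g x) \<le> norm ((norm (f x))\<^sup>2 + (norm (g x))\<^sup>2)" by simp
qed

lemma bounded_linear_axis: "bounded_linear (axis i :: 'a::euclidean_space \<Rightarrow> 'a ^ 'n)"
  unfolding linear_conv_bounded_linear[symmetric]
  by (rule linearI) (auto simp: vec_eq_iff axis_def)

lemma square_integrable_vec:
  fixes f :: "'a \<Rightarrow> 'b::euclidean_space ^ 'n"
  assumes "\<And>i. square_integrable M (\<lambda>x. f x $ i)"
  shows "square_integrable M f"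
proof -
  have "square_integrable M (\<lambda>x. \<Sum>i\<in>UNIV. axis i (f x $ i))"
    by (intro square_integrable_sum square_integrable_bounded_linear[OF bounded_linear_axis] assms)
  moreover have "(\<Sum>i\<in>UNIV. axis i (f x $ i)) = f x" for x
    by (simp add: vec_eq_iff axis_def if_distrib cong: if_cong)
  ultimately show ?thesis by simp
qed

lemma integrable_vec:
  fixes f :: "'a \<Rightarrow> 'b::euclidean_space ^ 'n"
  assumes "\<And>i. integrable M (\<lambda>x. f x $ i)"
  shows "integrable M f"
proof -
  have "integrable M (\<lambda>x. \<Sum>i\<in>UNIV. axis i (f x $ i))"
    by (intro Bochner_Integration.integrable_sum integrable_bounded_linear[OF bounded_linear_axis] assms)
  moreover have "(\<Sum>i\<in>UNIV. axis i (f x $ i)) = f x" for x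
    by (simp add: vec_eq_iff axis_def if_distrib cong: if_cong)
  ultimately show ?thesis by simp
qed

lemma continuous_on_square_integrable_hist:
  fixes f :: "real \<Rightarrow> 'a::euclidean_space"
  assumes "continuous_on {-1..0} f"
  shows "square_integrable hist_measure f"
  unfolding square_integrable_def
proof
  show "f \<in> borel_measurable hist_measure"
    using continuous_imp_integrable_real[OF assms] by auto
  show "integrable hist_measure (\<lambda>x. (norm (f x))\<^sup>2)"
    by (intro continuous_imp_integrable_real continuous_intros assms)
qed

lemma AC_hist_continuous_on:
  assumes "AC_hist f f'"
  shows "continuous_on {-1..0} f"
proof -
  have "continuous_on {-1..0} (\<lambda>\<theta>. f (-1) + (LINT s|lebesgue_on {-1..\<theta>}. f' s))"
    by (intro continuous_intros indefinite_integral_continuous_real AC_hist_integrable[OF assms])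
  then show ?thesis
    by (subst continuous_on_cong[OF refl AC_histD[OF assms]])
qed

lemma H1_hist_square_integrable:
  fixes \<phi> :: "real \<Rightarrow> 'a::euclidean_space"
  assumes "H1_hist \<phi> \<phi>'"
  shows "square_integrable hist_measure \<phi>"
proof (rule continuous_on_square_integrable_hist)
  have "continuous_on {-1..0} (\<lambda>\<theta>. \<phi> (-1) + (LINT s|lebesgue_on {-1..\<theta>}. \<phi>' s))"
    using assms unfolding H1_hist_def
    by (intro continuous_intros indefinite_integral_continuous_real square_integrable_hist_integrable) (rule conjunct1)
  then show "continuous_on {-1..0} \<phi>"
    by (subst continuous_on_cong[OF refl H1_histD[OF assms]])
qed

section \<open>Functionals on the state space\<close>

text \<open>The bilinear pairing of \<open>(v, \<phi>)\<close> with \<open>(w, k)\<close>, without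
  conjugation. As the history space is real, the complex kernel enters through the inner products
  with its real and imaginary parts; boundedness is then immediate, and
  \<open>state_functional_abs\<close> recovers the integral.\<close>

definition state_functional :: "complex ^ 'n \<Rightarrow> (real \<Rightarrow> complex ^ 'n) \<Rightarrow> 'n M2 \<Rightarrow> complex" where
  "state_functional w k x = (\<Sum>j\<in>UNIV. w $ j * of_real (fst x $ j)) +
     Complex (abs_L2_hist (\<lambda>s. \<chi> j. Re (k s $ j)) \<bullet> snd x) (abs_L2_hist (\<lambda>s. \<chi> j. Im (k s $ j)) \<bullet> snd x)"

lemma bounded_linear_state_functional: "bounded_linear (state_functional w k)"
proof -
  have C: "Complex a b = of_real a + \<i> * of_real b" for a b
    by (simp add: complex_eq_iff)
  show ?thesis
    unfolding state_functional_def C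
    by (intro bounded_linear_add bounded_linear_sum bounded_linear_const_mult
        bounded_linear_compose[OF bounded_linear_of_real] bounded_linear_inner_right_comp
        bounded_linear_compose[OF bounded_linear_vec_nth] bounded_linear_fst bounded_linear_snd)
qed

lemma state_functional_abs:
  assumes k: "\<And>j. square_integrable hist_measure (\<lambda>s. k s $ j)"
    and \<phi>: "square_integrable hist_measure \<phi>"
  shows "state_functional w k (v, abs_L2_hist \<phi>) = (\<Sum>j\<in>UNIV. w $ j * of_real (v $ j)) +
    (LINT s|hist_measure. (\<Sum>j\<in>UNIV. k s $ j * of_real (\<phi> s $ j)))"
proof -
  have \<phi>j: "square_integrable hist_measure (\<lambda>s. complex_of_real (\<phi> s $ j))" for j
    by (intro square_integrable_bounded_linear[OF bounded_linear_of_real]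
        square_integrable_bounded_linear[OF bounded_linear_vec_nth] \<phi>)
  have I: "integrable hist_measure (\<lambda>s. \<Sum>j\<in>UNIV. k s $ j * of_real (\<phi> s $ j))"
    by (intro Bochner_Integration.integrable_sum square_integrable_mult_integrable k \<phi>j)
  have "abs_L2_hist (\<lambda>s. \<chi> j. Re (k s $ j)) \<bullet> abs_L2_hist \<phi>
      = (LINT s|hist_measure. (\<chi> j. Re (k s $ j)) \<bullet> \<phi> s)"
    by (rule inner_L2_hist.abs_eq)
      (auto intro!: \<phi> square_integrable_vec square_integrable_bounded_linear[OF bounded_linear_Re] k)
  also have "\<dots> = (LINT s|hist_measure. Re (\<Sum>j\<in>UNIV. k s $ j * of_real (\<phi> s $ j)))"
    by (simp add: inner_vec_def)
  finally have 1: "abs_L2_hist (\<lambda>s. \<chi> j. Re (k s $ j)) \<bullet> abs_L2_hist \<phi>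
      = Re (LINT s|hist_measure. (\<Sum>j\<in>UNIV. k s $ j * of_real (\<phi> s $ j)))"
    using integral_Re[OF I] by simp
  have "abs_L2_hist (\<lambda>s. \<chi> j. Im (k s $ j)) \<bullet> abs_L2_hist \<phi>
      = (LINT s|hist_measure. (\<chi> j. Im (k s $ j)) \<bullet> \<phi> s)"
    by (rule inner_L2_hist.abs_eq)
      (auto intro!: \<phi> square_integrable_vec square_integrable_bounded_linear[OF bounded_linear_Im] k)
  also have "\<dots> = (LINT s|hist_measure. Im (\<Sum>j\<in>UNIV. k s $ j * of_real (\<phi> s $ j)))"
    by (simp add: inner_vec_def)
  finally have 2: "abs_L2_hist (\<lambda>s. \<chi> j. Im (k s $ j)) \<bullet> abs_L2_hist \<phi>
      = Im (LINT s|hist_measure. (\<Sum>j\<in>UNIV. k s $ j * of_real (\<phi> s $ j)))"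
    using integral_Im[OF I] by simp
  show ?thesis by (simp add: state_functional_def 1 2)
qed

lemma sum_matrix_vector_mult:
  fixes M :: "real ^ 'n ^ 'm"
  shows "(\<Sum>i\<in>UNIV. w $ i * complex_of_real ((M *v x) $ i))
    = (\<Sum>j\<in>UNIV. (\<Sum>i\<in>UNIV. w $ i * of_real (M $ i $ j)) * of_real (x $ j))"
proof -
  have "(\<Sum>i\<in>UNIV. w $ i * complex_of_real ((M *v x) $ i))
      = (\<Sum>i\<in>UNIV. \<Sum>j\<in>UNIV. w $ i * of_real (M $ i $ j) * of_real (x $ j))"
    by (simp add: matrix_vector_mult_def sum_distrib_left mult.assoc)
  also have "\<dots> = (\<Sum>j\<in>UNIV. \<Sum>i\<in>UNIV. w $ i * of_real (M $ i $ j) * of_real (x $ j))"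
    by (rule sum.swap)
  finally show ?thesis by (simp add: sum_distrib_right)
qed

text \<open>The product rule for each component, integrated from \<open>-1\<close> to
  \<open>0\<close>. It moves the derivative onto the kernel and produces the boundary values that
  the domain of the neutral operator ties to \<open>v\<close>.\<close>

lemma integral_by_parts_H1_hist:
  fixes \<phi> :: "real \<Rightarrow> real ^ 'n"
  assumes \<phi>: "H1_hist \<phi> \<phi>'" and p: "\<And>j. AC_hist (\<lambda>s. p s $ j) (\<lambda>s. p' s $ j)"
  shows "(LINT s|hist_measure. (\<Sum>j\<in>UNIV. p s $ j * of_real (\<phi>' s $ j))) =
    (\<Sum>j\<in>UNIV. p 0 $ j * of_real (\<phi> 0 $ j)) - (\<Sum>j\<in>UNIV. p (-1) $ j * of_real (\<phi> (-1) $ j))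
    - (LINT s|hist_measure. (\<Sum>j\<in>UNIV. p' s $ j * of_real (\<phi> s $ j)))"
proof -
  note ac = H1_hist_AC_hist[OF \<phi>]
  have i1: "integrable hist_measure (\<lambda>s. p s $ j * of_real (\<phi>' s $ j))" for j
    by (rule AC_hist_mult_integrable[OF p AC_hist_integrable[OF ac]])
  have i2: "integrable hist_measure (\<lambda>s. p' s $ j * of_real (\<phi> s $ j))" for j
    using AC_hist_mult_integrable[OF ac AC_hist_integrable[OF p]] by (simp add: mult.commute)
  have "(LINT s|hist_measure. p s $ j * of_real (\<phi>' s $ j))
      = p 0 $ j * of_real (\<phi> 0 $ j) - p (-1) $ j * of_real (\<phi> (-1) $ j)
        - (LINT s|hist_measure. p' s $ j * of_real (\<phi> s $ j))" for j
    using AC_hist_ends[OF AC_hist_mult[OF p ac], of j j] i1[of j] i2[of j] by (simp add: algebra_simps)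
  then show ?thesis
    using i1 i2 by (simp add: sum_subtractf)
qed

section \<open>Left null vectors of rank-deficient matrices\<close>

text \<open>If no nonzero left null vector existed, the rows would be independent and the row rank
  full. Distinctness of the rows needs its own argument, because \<open>rows A\<close> is a set in
  which equal rows collapse.\<close>

lemma rank_less_imp_left_kernel:
  fixes A :: "'a::field ^ 'm ^ 'n"
  assumes "rank A \<noteq> CARD('n)"
  obtains w :: "'a ^ 'n" where "w \<noteq> 0" "\<And>j. (\<Sum>i\<in>UNIV. w $ i * A $ i $ j) = 0"
proof -
  have "\<exists>w :: 'a ^ 'n. w \<noteq> 0 \<and> (\<forall>j. (\<Sum>i\<in>UNIV. w $ i * A $ i $ j) = 0)"
  proof (rule ccontr)
    assume neg: "\<not> ?thesis"
    have triv: "\<forall>i. c i = 0" if "(\<Sum>i\<in>UNIV. c i *s row i A) = 0" for c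
    proof -
      have "(\<Sum>i\<in>UNIV. c i * A $ i $ j) = 0" for j
        using arg_cong[OF that, of "\<lambda>v. v $ j"] by (simp add: row_def)
      then show ?thesis
        using neg by (auto simp: vec_eq_iff dest!: spec[of _ "\<chi> i. c i"])
    qed
    have inj: "inj (\<lambda>i. row i A)"
    proof (rule injI, rule ccontr)
      fix i j assume ij: "row i A = row j A" "i \<noteq> j"
      \<comment> \<open>Two equal rows have the null combination with coefficients \<open>1\<close>
        and \<open>-1\<close>.\<close>
      have "(\<Sum>k\<in>UNIV. (if k = i then 1 else if k = j then -1 else 0) *s row k A)
          = (\<Sum>k\<in>{i, j}. (if k = i then 1 else if k = j then -1 else 0) *s row k A)"
        by (rule sum.mono_neutral_right) auto
      also have "\<dots> = 0" using ij by (simp add: vec_eq_iff)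
      finally show False
        using triv[of "\<lambda>k. if k = i then 1 else if k = j then -1 else 0"] by (auto split: if_splits)
    qed
    have rows: "rows A = range (\<lambda>i. row i A)" by (auto simp: rows_def)
    have "vec.independent (rows A)"
    proof (rule vec.independent_if_scalars_zero)
      show "finite (rows A)" by (simp add: rows)
      fix f x assume s: "(\<Sum>x\<in>rows A. f x *s x) = 0" and x: "x \<in> rows A"
      have "(\<Sum>i\<in>UNIV. f (row i A) *s row i A) = 0"
        using s inj by (simp add: rows sum.reindex o_def)
      then show "f x = 0" using triv[of "\<lambda>i. f (row i A)"] x by (auto simp: rows)
    qed
    then have "rank A = card (rows A)"
      unfolding row_rank_def_gen by (rule vec.dim_eq_card_independent)
    also have "\<dots> = CARD('n)" by (simp add: rows card_image inj)
    finally show False using assms by simp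
  qed
  then show ?thesis using that by blast
qed

lemma append_columns_left_kernel:
  fixes w :: "'a::comm_ring_1 ^ 'n"
  assumes "\<And>j. (\<Sum>i\<in>UNIV. w $ i * append_columns M N $ i $ j) = 0"
  shows "(\<Sum>i\<in>UNIV. w $ i * M $ i $ k) = 0" "(\<Sum>i\<in>UNIV. w $ i * N $ i $ l) = 0"
  using assms[of "Inl k"] assms[of "Inr l"] by (simp_all add: append_columns_def)

section \<open>Eigenfunctionals of the neutral operator\<close>

lemma square_integrable_of_real_nth:
  fixes \<phi> :: "'a \<Rightarrow> real ^ 'n"
  assumes "square_integrable M \<phi>"
  shows "square_integrable M (\<lambda>s. complex_of_real (\<phi> s $ j))"
  by (intro square_integrable_bounded_linear[OF bounded_linear_of_real]
      square_integrable_bounded_linear[OF bounded_linear_vec_nth] assms)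

lemma integrable_matrix_vector_mult:
  fixes A :: "'a \<Rightarrow> real ^ 'n ^ 'm"
  assumes A: "\<And>i j. square_integrable M (\<lambda>s. A s $ i $ j)" and x: "square_integrable M x"
  shows "integrable M (\<lambda>s. A s *v x s)"
proof (rule integrable_vec)
  fix i
  have "integrable M (\<lambda>s. \<Sum>j\<in>UNIV. A s $ i $ j \<bullet> x s $ j)"
    by (intro Bochner_Integration.integrable_sum square_integrable_inner A
        square_integrable_bounded_linear[OF bounded_linear_vec_nth] x)
  then show "integrable M (\<lambda>s. (A s *v x s) $ i)"
    by (simp add: matrix_vector_mult_def)
qed

text \<open>The kernel is \<open>p - w\<^sup>T A\<^sub>2\<close>, where \<open>p\<close> solves the adjoint equation \<open>p' = - z * p + w\<^sup>T (z * A\<^sub>2 + A\<^sub>3)\<close>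
  with \<open>p 0 = z * w\<close>; the hypothesis on \<open>w\<close> says that \<open>p (-1) = z * w\<^sup>T A\<^sub>-\<^sub>1\<close>, so that the boundary
  terms of the integration by parts combine to \<open>z * (w \<bullet> v)\<close>.\<close>

lemma state_functional_neutral_operator:
  fixes Am1 :: "real ^ 'n ^ 'n" and A2 A3 :: "real \<Rightarrow> real ^ 'n ^ 'n"
  assumes A2: "\<And>i j. square_integrable hist_measure (\<lambda>\<theta>. A2 \<theta> $ i $ j)"
    and A3: "\<And>i j. square_integrable hist_measure (\<lambda>\<theta>. A3 \<theta> $ i $ j)"
    and w: "\<And>j. (\<Sum>i\<in>UNIV. w $ i * char_matrix Am1 A2 A3 z $ i $ j) = 0"
  obtains k where "\<And>x y. (x, y) \<in> neutral_operator Am1 A2 A3 \<Longrightarrow>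
    state_functional w k y = z * state_functional w k x"
proof -
  define a2 where "a2 s = (\<chi> j. \<Sum>i\<in>UNIV. w $ i * complex_of_real (A2 s $ i $ j))" for s
  define a3 where "a3 s = (\<chi> j. \<Sum>i\<in>UNIV. w $ i * complex_of_real (A3 s $ i $ j))" for s
  define q where "q s j = z * a2 s $ j + a3 s $ j" for s j
  have a2: "square_integrable hist_measure (\<lambda>s. a2 s $ j)" for j
    unfolding a2_def vec_lambda_beta
    by (intro square_integrable_sum square_integrable_bounded_linear[OF bounded_linear_mult_right]
        square_integrable_bounded_linear[OF bounded_linear_of_real] A2)
  have a3: "square_integrable hist_measure (\<lambda>s. a3 s $ j)" for j
    unfolding a3_def vec_lambda_beta
    by (intro square_integrable_sum square_integrable_bounded_linear[OF bounded_linear_mult_right]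
        square_integrable_bounded_linear[OF bounded_linear_of_real] A3)
  note intA = square_integrable_hist_integrable[OF square_integrable_bounded_linear[OF bounded_linear_of_real A2]]
    square_integrable_hist_integrable[OF square_integrable_bounded_linear[OF bounded_linear_of_real A3]]
  note int_exp = AC_hist_mult_integrable[OF AC_hist_exp[of z]]
  have q: "integrable hist_measure (\<lambda>s. q s j)" for j
    unfolding q_def using square_integrable_hist_integrable[OF a2[of j]] square_integrable_hist_integrable[OF a3[of j]]
    by simp
  \<comment> \<open>The integration constant that makes \<open>P j 0\<close>, and hence
    \<open>p 0 $ j\<close>, equal to \<open>z * w $ j\<close>.\<close>
  define c where "c j = z * w $ j - (LINT s|hist_measure. exp (z * of_real s) * q s j)" for j
  define P where "P j \<theta> = c j + (LINT s|lebesgue_on {-1..\<theta>}. exp (z * of_real s) * q s j)" for j \<theta>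
  define p where "p \<theta> = (\<chi> j. exp (- z * of_real \<theta>) * P j \<theta>)" for \<theta>
  define p' where "p' \<theta> = (\<chi> j. - z * p \<theta> $ j + q \<theta> j)" for \<theta>
  have p: "AC_hist (\<lambda>s. p s $ j) (\<lambda>s. p' s $ j)" for j
  proof -
    have "AC_hist (\<lambda>s. exp (- z * of_real s) * P j s)
        (\<lambda>s. (- z * exp (- z * of_real s)) * P j s + exp (- z * of_real s) * (exp (z * of_real s) * q s j))"
      unfolding P_def by (intro AC_hist_mult AC_hist_exp AC_hist_antiderivative int_exp q)
    moreover have "exp (- z * complex_of_real s) * (exp (z * of_real s) * q s j) = q s j" for s
      by (simp only: mult.assoc[symmetric] exp_add[symmetric]) simp
    ultimately show ?thesis by (simp only: p_def p'_def vec_lambda_beta mult.assoc)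
  qed
  have p0: "p 0 $ j = z * w $ j" for j
    by (simp add: p_def P_def c_def)
  \<comment> \<open>Column \<open>j\<close> of the null vector equation for the characteristic
    matrix, solved for \<open>c j\<close>; this is where the spectral hypothesis becomes the
    boundary condition at \<open>-1\<close>.\<close>
  have c: "c j = z * exp (- z) * (\<Sum>i\<in>UNIV. w $ i * of_real (Am1 $ i $ j))" for j
  proof -
    define L where "L i = (LINT s|hist_measure. z * exp (z * of_real s) * of_real (A2 s $ i $ j)
            + exp (z * of_real s) * of_real (A3 s $ i $ j))" for i
    have "(\<Sum>i\<in>UNIV. w $ i * L i)
        = (LINT s|hist_measure. (\<Sum>i\<in>UNIV. w $ i * (z * exp (z * of_real s) * of_real (A2 s $ i $ j)
            + exp (z * of_real s) * of_real (A3 s $ i $ j))))"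
      unfolding L_def
    proof (subst Bochner_Integration.integral_sum)
      fix i
      have "integrable hist_measure (\<lambda>s. z * (exp (z * of_real s) * of_real (A2 s $ i $ j))
            + exp (z * of_real s) * of_real (A3 s $ i $ j))"
        using int_exp[OF intA(1)[of i j]] int_exp[OF intA(2)[of i j]] by simp
      then show "integrable hist_measure (\<lambda>s. w $ i * (z * exp (z * of_real s) * of_real (A2 s $ i $ j)
            + exp (z * of_real s) * of_real (A3 s $ i $ j)))"
        by (simp add: mult.assoc)
    qed simp
    also have "\<dots> = (LINT s|hist_measure. exp (z * of_real s) * q s j)"
      by (intro Bochner_Integration.integral_cong refl)
        (simp add: q_def a2_def a3_def sum_distrib_left sum.distrib algebra_simps)
    finally have L: "(\<Sum>i\<in>UNIV. w $ i * L i) = (LINT s|hist_measure. exp (z * of_real s) * q s j)" .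
    have "(\<Sum>i\<in>UNIV. w $ i * mat z $ i $ j) = z * w $ j"
      by (simp add: mat_def if_distrib cong: if_cong)
    moreover have "0 = (\<Sum>i\<in>UNIV. w $ i * mat z $ i $ j)
        - (\<Sum>i\<in>UNIV. w $ i * (z * exp (- z) * of_real (Am1 $ i $ j))) - (\<Sum>i\<in>UNIV. w $ i * L i)"
      unfolding w[of j, symmetric] char_matrix_def vec_lambda_beta L_def
      by (simp only: right_diff_distrib sum_subtractf)
    moreover have "(\<Sum>i\<in>UNIV. w $ i * (z * exp (- z) * complex_of_real (Am1 $ i $ j)))
        = z * exp (- z) * (\<Sum>i\<in>UNIV. w $ i * of_real (Am1 $ i $ j))"
      by (simp add: sum_distrib_left mult_ac)
    ultimately show ?thesis
      unfolding L c_def by (simp add: algebra_simps)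
  qed
  have p1: "p (-1) $ j = z * (\<Sum>i\<in>UNIV. w $ i * of_real (Am1 $ i $ j))" for j
  proof -
    have "(LINT s|lebesgue_on {-1..-1::real}. exp (z * of_real s) * q s j) = 0"
      by (rule integral_eq_zero_null_sets) (simp add: null_sets_completionI)
    then have "p (-1) $ j = exp z * c j" by (simp add: p_def P_def)
    also have "\<dots> = exp z * exp (- z) * (z * (\<Sum>i\<in>UNIV. w $ i * of_real (Am1 $ i $ j)))"
      by (simp add: c)
    finally show ?thesis by (simp add: exp_add[symmetric])
  qed
  \<comment> \<open>Subtracting \<open>a2\<close> cancels the term with \<open>A2\<close> and
    \<open>\<phi>'\<close> that the first component of the operator contributes.\<close>
  define k where "k s = (\<chi> j. p s $ j - a2 s $ j)" for s
  have psq: "square_integrable hist_measure (\<lambda>s. p s $ j)" for j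
    by (rule continuous_on_square_integrable_hist[OF AC_hist_continuous_on[OF p]])
  have k: "square_integrable hist_measure (\<lambda>s. k s $ j)" for j
    by (simp add: k_def square_integrable_diff psq a2)
  show ?thesis
  proof (rule that[of k])
    fix x y assume "(x, y) \<in> neutral_operator Am1 A2 A3"
    then obtain \<phi> \<phi>' where H: "H1_hist \<phi> \<phi>'"
      and x: "x = (\<phi> 0 - Am1 *v \<phi> (-1), abs_L2_hist \<phi>)"
      and y: "y = (LINT \<theta>|hist_measure. A2 \<theta> *v \<phi>' \<theta> + A3 \<theta> *v \<phi> \<theta>, abs_L2_hist \<phi>')"
      unfolding neutral_operator_def by blast
    have \<phi>: "square_integrable hist_measure \<phi>" by (rule H1_hist_square_integrable[OF H])
    have \<phi>': "square_integrable hist_measure \<phi>'" using H unfolding H1_hist_def by (rule conjunct1)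
    have I: "integrable hist_measure (\<lambda>s. \<Sum>j\<in>UNIV. g s $ j * complex_of_real (\<psi> s $ j))"
      if "\<And>j. square_integrable hist_measure (\<lambda>s. g s $ j)" "square_integrable hist_measure \<psi>"
      for g :: "real \<Rightarrow> complex ^ 'n" and \<psi> :: "real \<Rightarrow> real ^ 'n"
      by (intro Bochner_Integration.integrable_sum square_integrable_mult_integrable that
          square_integrable_of_real_nth)
    define J where "J g \<psi> = (LINT s|hist_measure. (\<Sum>j\<in>UNIV. g s $ j * complex_of_real (\<psi> s $ j)))"
      for g :: "real \<Rightarrow> complex ^ 'n" and \<psi> :: "real \<Rightarrow> real ^ 'n"
    have Jk: "J k \<psi> = J p \<psi> - J a2 \<psi>" if "square_integrable hist_measure \<psi>" for \<psi>
      unfolding J_def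
      by (subst Bochner_Integration.integral_diff[symmetric])
        (use that in \<open>auto intro!: I psq a2 simp: k_def sum_subtractf left_diff_distrib\<close>)
    \<comment> \<open>The adjoint equation tested against \<open>\<phi>\<close>: its
      \<open>a3\<close> part cancels the term with \<open>A3\<close>, and the rest is
      \<open>- z\<close> times the pairing with \<open>k\<close>.\<close>
    have Jp': "J p' \<phi> = - z * J p \<phi> + (z * J a2 \<phi> + J a3 \<phi>)"
    proof -
      have "J p' \<phi> = (LINT s|hist_measure. - z * (\<Sum>j\<in>UNIV. p s $ j * complex_of_real (\<phi> s $ j))
          + (z * (\<Sum>j\<in>UNIV. a2 s $ j * complex_of_real (\<phi> s $ j))
          + (\<Sum>j\<in>UNIV. a3 s $ j * complex_of_real (\<phi> s $ j))))"
        unfolding J_def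
        by (intro Bochner_Integration.integral_cong refl)
          (simp add: p'_def q_def sum_distrib_left sum.distrib[symmetric] sum_subtractf[symmetric] algebra_simps)
      also have "\<dots> = - z * J p \<phi> + (z * J a2 \<phi> + J a3 \<phi>)"
        using I[OF psq \<phi>] I[OF a2 \<phi>] I[OF a3 \<phi>] unfolding J_def by simp
      finally show ?thesis .
    qed
    have "J p \<phi>' = (\<Sum>j\<in>UNIV. p 0 $ j * of_real (\<phi> 0 $ j)) - (\<Sum>j\<in>UNIV. p (-1) $ j * of_real (\<phi> (-1) $ j)) - J p' \<phi>"
      unfolding J_def by (rule integral_by_parts_H1_hist[OF H p])
    then have Jp: "J p \<phi>' = z * (\<Sum>j\<in>UNIV. w $ j * of_real (\<phi> 0 $ j))
        - z * (\<Sum>j\<in>UNIV. (\<Sum>i\<in>UNIV. w $ i * of_real (Am1 $ i $ j)) * of_real (\<phi> (-1) $ j)) - J p' \<phi>"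
      by (simp only: p0 p1 sum_distrib_left[symmetric] mult.assoc)
    have first: "(\<Sum>i\<in>UNIV. w $ i * of_real ((LINT \<theta>|hist_measure. A2 \<theta> *v \<phi>' \<theta> + A3 \<theta> *v \<phi> \<theta>) $ i))
        = J a2 \<phi>' + J a3 \<phi>"
    proof -
      have i1: "integrable hist_measure (\<lambda>\<theta>. A2 \<theta> *v \<phi>' \<theta> + A3 \<theta> *v \<phi> \<theta>)"
        by (intro Bochner_Integration.integrable_add integrable_matrix_vector_mult A2 A3 \<phi> \<phi>')
      define h where "h v = (\<Sum>i\<in>UNIV. w $ i * complex_of_real (v $ i))" for v :: "real ^ 'n"
      have h: "bounded_linear h"
        unfolding h_def[abs_def]
        by (intro bounded_linear_sum bounded_linear_const_mult
            bounded_linear_compose[OF bounded_linear_of_real] bounded_linear_vec_nth)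
      have "h (LINT \<theta>|hist_measure. A2 \<theta> *v \<phi>' \<theta> + A3 \<theta> *v \<phi> \<theta>)
          = (LINT \<theta>|hist_measure. h (A2 \<theta> *v \<phi>' \<theta> + A3 \<theta> *v \<phi> \<theta>))"
        by (rule integral_bounded_linear[OF h i1, symmetric])
      also have "\<dots> = (LINT \<theta>|hist_measure. (\<Sum>j\<in>UNIV. a2 \<theta> $ j * of_real (\<phi>' \<theta> $ j))
          + (\<Sum>j\<in>UNIV. a3 \<theta> $ j * of_real (\<phi> \<theta> $ j)))"
        using linear_add[OF bounded_linear.linear[OF h]]
        by (simp add: h_def sum_matrix_vector_mult a2_def a3_def)
      also have "\<dots> = J a2 \<phi>' + J a3 \<phi>"
        unfolding J_def by (intro Bochner_Integration.integral_add I a2 a3 \<phi> \<phi>')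
      finally show ?thesis by (simp add: h_def)
    qed
    have fy: "state_functional w k y = J a2 \<phi>' + J a3 \<phi> + J k \<phi>'"
      unfolding y by (simp only: state_functional_abs[OF k \<phi>'] first J_def)
    have fx: "state_functional w k x = (\<Sum>j\<in>UNIV. w $ j * of_real (\<phi> 0 $ j))
        - (\<Sum>j\<in>UNIV. (\<Sum>i\<in>UNIV. w $ i * of_real (Am1 $ i $ j)) * of_real (\<phi> (-1) $ j)) + J k \<phi>"
      unfolding x state_functional_abs[OF k \<phi>]
      by (simp add: right_diff_distrib sum_subtractf sum_matrix_vector_mult J_def)
    show "state_functional w k y = z * state_functional w k x"
      unfolding fx fy Jk[OF \<phi>] Jk[OF \<phi>'] Jp Jp' by (simp add: algebra_simps)
  qed
qed

section \<open>Necessary conditions for null controllability\<close>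

text \<open>Along an orbit \<open>f\<close> is only multiplied by the nonzero factor
  \<open>exp (z * of_real t)\<close>, and it stays \<open>0\<close> on every control contribution.
  Arriving at the zero state therefore forces \<open>f x = 0\<close>.\<close>

lemma exactly_null_controllable_eigenfunctional:
  fixes S :: "real \<Rightarrow> 'a::{banach, second_countable_topology} \<Rightarrow> 'a"
  assumes S: "C0_semigroup S" and f: "bounded_linear f"
    and eq: "\<And>x y. (x, y) \<in> infinitesimal_generator S \<Longrightarrow> f y = (z::complex) * f x"
    and fB: "\<And>u. f (\<B> u) = 0" and null: "exactly_null_controllable S \<B>"
  shows "f x = 0"
proof -
  interpret f: bounded_linear f by (rule f)
  have fS: "f (S t x) = exp (z * of_real t) * f x" if "0 \<le> t" for t x
    using C0_semigroup_functional[OF S f bounded_linear_zero, of z t x] eq that by simp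
  obtain T u where T: "T > 0" and 0: "S T x + (LINT \<tau>|lebesgue_on {0..T}. S (T - \<tau>) (\<B> (u \<tau>))) = 0"
    using null unfolding exactly_null_controllable_def by blast
  \<comment> \<open>If the integrand is not integrable, the Bochner integral is \<open>0\<close> by
    convention and the claim still holds.\<close>
  have "f (LINT \<tau>|lebesgue_on {0..T}. S (T - \<tau>) (\<B> (u \<tau>))) = 0"
  proof (cases "integrable (lebesgue_on {0..T}) (\<lambda>\<tau>. S (T - \<tau>) (\<B> (u \<tau>)))")
    case True
    have "f (LINT \<tau>|lebesgue_on {0..T}. S (T - \<tau>) (\<B> (u \<tau>)))
        = (LINT \<tau>|lebesgue_on {0..T}. f (S (T - \<tau>) (\<B> (u \<tau>))))"
      by (rule integral_bounded_linear[OF f True, symmetric])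
    also have "\<dots> = (LINT \<tau>|lebesgue_on {0..T}. 0)"
      by (intro Bochner_Integration.integral_cong refl) (simp add: fS fB)
    finally show ?thesis by simp
  qed (simp add: not_integrable_integral_eq f.zero)
  then have "f (S T x) = 0" using arg_cong[OF 0, of f] by (simp add: f.add f.zero)
  then show ?thesis using fS[of T x] T by simp
qed

lemma state_functional_zero_history:
  "state_functional w k (v, 0) = (\<Sum>j\<in>UNIV. w $ j * of_real (v $ j))"
  by (simp add: state_functional_def Complex_eq_0)

text \<open>A left null vector \<open>w\<close> of the extended matrix annihilates both blocks: the
  first block yields an eigenfunctional, the second makes it vanish on controls. It must then be
  zero, yet on states with zero history it is the pairing with \<open>w\<close>.\<close>

lemma char_matrix_full_rank:
  fixes Am1 :: "real ^ 'n ^ 'n" and B :: "real ^ 'm ^ 'n"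
  assumes A2: "\<And>i j. square_integrable hist_measure (\<lambda>\<theta>. A2 \<theta> $ i $ j)"
    and A3: "\<And>i j. square_integrable hist_measure (\<lambda>\<theta>. A3 \<theta> $ i $ j)"
    and gen: "generates_C0_semigroup (neutral_operator Am1 A2 A3) S"
    and null: "exactly_null_controllable S (control_operator B)"
  shows "rank (append_columns (char_matrix Am1 A2 A3 z) (complex_matrix B)) = CARD('n)"
proof (rule ccontr)
  assume "\<not> ?thesis"
  then obtain w :: "complex ^ 'n" where w: "w \<noteq> 0"
    "\<And>j. (\<Sum>i\<in>UNIV. w $ i * append_columns (char_matrix Am1 A2 A3 z) (complex_matrix B) $ i $ j) = 0"
    using rank_less_imp_left_kernel by blast
  obtain k where k: "\<And>x y. (x, y) \<in> neutral_operator Am1 A2 A3 \<Longrightarrow>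
    state_functional w k y = z * state_functional w k x"
    using state_functional_neutral_operator[OF A2 A3 append_columns_left_kernel(1)[OF w(2)]] by blast
  have wB: "(\<Sum>i\<in>UNIV. w $ i * of_real (B $ i $ l)) = 0" for l
    using append_columns_left_kernel(2)[OF w(2), of l] by (simp add: complex_matrix_def)
  have f0: "state_functional w k x = 0" for x
  proof (rule exactly_null_controllable_eigenfunctional[OF _ bounded_linear_state_functional _ _ null])
    show "C0_semigroup S" using gen by (simp add: generates_C0_semigroup_def)
    show "state_functional w k y = z * state_functional w k x"
      if "(x, y) \<in> infinitesimal_generator S" for x y
      using that gen k by (simp add: generates_C0_semigroup_def)
    show "state_functional w k (control_operator B u) = 0" for u
      by (simp add: control_operator_def state_functional_zero_history sum_matrix_vector_mult wB)
  qed
  obtain i where "w $ i \<noteq> 0" using w(1) by (auto simp: vec_eq_iff)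
  moreover have "state_functional w k (axis i 1, 0) = w $ i"
    by (simp add: state_functional_zero_history axis_def if_distrib cong: if_cong)
  ultimately show False using f0 by simp
qed

section \<open>An L1 estimate for combinations of functionals\<close>

lemma square_integrable_integrable_norm:
  assumes "finite_measure M" "square_integrable M f"
  shows "integrable M (\<lambda>x. norm (f x))"
proof (rule Bochner_Integration.integrable_bound)
  interpret finite_measure M by fact
  show "integrable M (\<lambda>x. 1 + (norm (f x))\<^sup>2)"
    using square_integrable_norm2[OF assms(2)] by simp
  show "(\<lambda>x. norm (f x)) \<in> borel_measurable M"
    using square_integrable_measurable[OF assms(2)] by measurable
  have "norm (f x) \<le> 1 + (norm (f x))\<^sup>2" for x
    using sum_squares_bound[of "norm (f x)" 1] norm_ge_zero[of "f x"] by (simp del: norm_ge_zero)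
  then show "AE x in M. norm (norm (f x)) \<le> norm (1 + (norm (f x))\<^sup>2)"
    by (simp add: add_nonneg_nonneg)
qed

text \<open>Each term of the steered trajectory at time \<open>T\<close> contributes an integral of
  a shifted exponential sum \<open>g\<close> against a bounded function, hence at most a constant
  times the L1 norm of \<open>g\<close>. The constant may depend on \<open>x\<close> but not on the
  frequencies and coefficients, and this uniformity is what the later contradiction
  exploits.\<close>

lemma exactly_null_controllable_functional_bound:
  fixes S :: "real \<Rightarrow> 'a::{banach, second_countable_topology} \<Rightarrow> 'a" and l :: "'a \<Rightarrow> complex"
  assumes S: "C0_semigroup S" and l: "bounded_linear l" and \<B>: "bounded_linear \<B>"
    and f: "\<And>z. z \<in> Z \<Longrightarrow> bounded_linear (f z)"
    and eq: "\<And>z x y. z \<in> Z \<Longrightarrow> (x, y) \<in> infinitesimal_generator S \<Longrightarrow> f z y = z * f z x + l x"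
    and fB: "\<And>z u. z \<in> Z \<Longrightarrow> f z (\<B> u) = 0"
    and null: "exactly_null_controllable S \<B>"
  obtains T where "T > 0" "\<And>x. \<exists>C\<ge>0. \<forall>K z c. finite K \<longrightarrow> z ` K \<subseteq> Z \<longrightarrow>
    norm (\<Sum>i\<in>K. c i * f (z i) x)
      \<le> C * integral {0..T} (\<lambda>s. norm (\<Sum>i\<in>(K::nat set). c i * exp (- z i * of_real s)))"
proof -
  obtain T where T: "T > 0" and ctrl: "\<And>x. \<exists>u. square_integrable (lebesgue_on {0..T}) u \<and>
        S T x + (LINT \<tau>|lebesgue_on {0..T}. S (T - \<tau>) (\<B> (u \<tau>))) = 0"
    using null unfolding exactly_null_controllable_def by blast
  obtain M where M: "M > 0" "\<And>t x. t \<in> {0..T} \<Longrightarrow> norm (S t x) \<le> M * norm x"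
    using C0_semigroup_bounded[OF S, of T] by blast
  obtain L where L: "L \<ge> 0" "\<And>x. norm (l x) \<le> norm x * L"
    using bounded_linear.nonneg_bounded[OF l] by blast
  obtain b where b: "b \<ge> 0" "\<And>u. norm (\<B> u) \<le> norm u * b"
    using bounded_linear.nonneg_bounded[OF \<B>] by blast
  show ?thesis
  proof (rule that[OF T])
    fix x
    obtain u where u: "square_integrable (lebesgue_on {0..T}) u" and 0: "S T x + (LINT \<tau>|lebesgue_on {0..T}. S (T - \<tau>) (\<B> (u \<tau>))) = 0"
      using ctrl by blast
    have ui: "integrable (lebesgue_on {0..T}) (\<lambda>\<tau>. norm (u \<tau>))"
      by (rule square_integrable_integrable_norm[OF _ u])
        (rule finite_measureI, simp add: emeasure_restrict_space emeasure_lborel_Icc_eq)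
    define V where "V \<tau> = S (T - \<tau>) (\<B> (u \<tau>))" for \<tau>
    define A where "A = (LINT \<tau>|lebesgue_on {0..T}. norm (u \<tau>))"
    have A: "A \<ge> 0" by (simp add: A_def)
    show "\<exists>C\<ge>0. \<forall>K z c. finite K \<longrightarrow> z ` K \<subseteq> Z \<longrightarrow> norm (\<Sum>i\<in>K. c i * f (z i) x)
        \<le> C * integral {0..T} (\<lambda>s. norm (\<Sum>i\<in>(K::nat set). c i * exp (- z i * of_real s)))"
    proof (intro exI conjI allI impI)
      \<comment> \<open>The constant is fixed before \<open>K\<close>, \<open>z\<close> and
        \<open>c\<close>: it involves only \<open>x\<close> and the L1 norm \<open>A\<close> of one
        control steering \<open>x\<close> to zero.\<close>
      show "M * L * norm x + M * L * b * A \<ge> 0"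
        using M L b A by simp
      fix K :: "nat set" and z :: "nat \<Rightarrow> complex" and c :: "nat \<Rightarrow> complex"
      assume K: "finite K" "z ` K \<subseteq> Z"
      define g where "g s = (\<Sum>i\<in>K. c i * exp (- z i * complex_of_real s))" for s
      define I where "I = integral {0..T} (\<lambda>s. norm (g s))"
      \<comment> \<open>The factors \<open>exp (- z i * of_real T)\<close> undo the growth over
        \<open>{0..T}\<close>, so that \<open>D (S T x)\<close> is the wanted combination at
        \<open>x\<close> plus an integral of \<open>g\<close> against
        \<open>l (S s x)\<close>.\<close>
      define D where "D y = (\<Sum>i\<in>K. (c i * exp (- z i * of_real T)) * f (z i) y)" for y
      have g: "continuous_on UNIV g"
        unfolding g_def by (intro continuous_intros)
      have gi: "(\<lambda>s. norm (g s)) integrable_on {r..t}" for r t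
        by (intro integrable_continuous_real continuous_intros continuous_on_subset[OF g]) auto
      have D: "bounded_linear D"
        unfolding D_def[abs_def] using K by (intro bounded_linear_sum bounded_linear_const_mult f) auto
      interpret D: bounded_linear D by (rule D)
      \<comment> \<open>For a shorter time \<open>t\<close> the function \<open>g\<close> is shifted
        by \<open>T - t\<close>; its window \<open>{T - t..T}\<close> stays inside
        \<open>{0..T}\<close>, so the same bound \<open>I\<close> serves for all
        \<open>t\<close>.\<close>
      have est: "norm (D (S t y) - (\<Sum>i\<in>K. c i * exp (- z i * of_real (T - t)) * f (z i) y)) \<le> M * L * norm y * I"
        if t: "t \<in> {0..T}" for t y
      proof -
        have Sc: "continuous_on {0..t} (\<lambda>s. l (S s y))"
          by (intro bounded_linear.continuous_on[OF l] C0_semigroup_continuous_on S)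
        have "(c i * exp (- z i * of_real T)) * f (z i) (S t y)
            = c i * exp (- z i * of_real (T - t)) * f (z i) y
              + integral {0..t} (\<lambda>s. c i * exp (- z i * of_real (T - t + s)) * l (S s y))" if i: "i \<in> K" for i
        proof -
          have e: "exp (- z i * of_real T) * exp (z i * of_real t) = exp (- z i * of_real (T - t))"
            by (simp add: exp_add[symmetric] algebra_simps)
          have zi: "z i \<in> Z" using i K by auto
          have "f (z i) (S t y) = exp (z i * of_real t) * (f (z i) y + integral {0..t} (\<lambda>s. exp (- z i * of_real s) * l (S s y)))"
            using t by (intro C0_semigroup_functional[OF S f[OF zi] l eq[OF zi]]) auto
          then have "(c i * exp (- z i * of_real T)) * f (z i) (S t y)
              = c i * (exp (- z i * of_real T) * exp (z i * of_real t))
                * (f (z i) y + integral {0..t} (\<lambda>s. exp (- z i * of_real s) * l (S s y)))"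
            by (simp only: mult.assoc)
          also have "\<dots> = c i * exp (- z i * of_real (T - t)) * f (z i) y
              + integral {0..t} (\<lambda>s. (c i * exp (- z i * of_real (T - t))) * (exp (- z i * of_real s) * l (S s y)))"
            unfolding e by (simp add: distrib_left)
          also have "(\<lambda>s. (c i * exp (- z i * of_real (T - t))) * (exp (- z i * of_real s) * l (S s y)))
              = (\<lambda>s. c i * exp (- z i * of_real (T - t + s)) * l (S s y))"
            by (rule ext) (simp add: exp_add[symmetric] exp_diff exp_minus field_simps)
          finally show ?thesis .
        qed
        then have "D (S t y) = (\<Sum>i\<in>K. c i * exp (- z i * of_real (T - t)) * f (z i) y
              + integral {0..t} (\<lambda>s. c i * exp (- z i * of_real (T - t + s)) * l (S s y)))"
          unfolding D_def by (intro sum.cong refl)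
        also have "\<dots> = (\<Sum>i\<in>K. c i * exp (- z i * of_real (T - t)) * f (z i) y)
            + integral {0..t} (\<lambda>s. \<Sum>i\<in>K. c i * exp (- z i * of_real (T - t + s)) * l (S s y))"
          unfolding sum.distrib
          by (subst integral_sum[OF K(1)]) (auto intro!: integrable_continuous_real continuous_intros Sc)
        also have "(\<lambda>s. \<Sum>i\<in>K. c i * exp (- z i * of_real (T - t + s)) * l (S s y))
            = (\<lambda>s. g (s + (T - t)) * l (S s y))"
          by (simp add: g_def sum_distrib_right add.commute)
        finally have "norm (D (S t y) - (\<Sum>i\<in>K. c i * exp (- z i * of_real (T - t)) * f (z i) y))
            = norm (integral {0..t} (\<lambda>s. g (s + (T - t)) * l (S s y)))" by simp
        also have "\<dots> \<le> integral {0..t} (\<lambda>s. (M * L * norm y) * norm (g (s + (T - t))))"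
        proof (rule integral_norm_bound_integral)
          have gs: "continuous_on {0..t} (\<lambda>s. g (s + (T - t)))"
            by (intro continuous_on_compose2[OF g] continuous_intros) auto
          show "(\<lambda>s. g (s + (T - t)) * l (S s y)) integrable_on {0..t}"
            by (intro integrable_continuous_real continuous_intros gs Sc)
          show "(\<lambda>s. (M * L * norm y) * norm (g (s + (T - t)))) integrable_on {0..t}"
            by (intro integrable_continuous_real continuous_intros gs)
          fix s assume s: "s \<in> {0..t}"
          have "norm (l (S s y)) \<le> norm (S s y) * L" by (rule L)
          also have "\<dots> \<le> (M * norm y) * L"
            using s t L by (intro mult_right_mono M(2)) auto
          finally have "norm (l (S s y)) \<le> M * L * norm y" by (simp add: mult_ac)
          from mult_right_mono[OF this, of "norm (g (s + (T - t)))"]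
          show "norm (g (s + (T - t)) * l (S s y)) \<le> (M * L * norm y) * norm (g (s + (T - t)))"
            by (simp add: norm_mult mult.commute)
        qed
        also have "\<dots> = (M * L * norm y) * integral {0..t} (\<lambda>s. norm (g (s + (T - t))))"
          by simp
        also have "integral {0..t} (\<lambda>s. norm (g (s + (T - t)))) = integral {T - t..T} (\<lambda>s. norm (g s))"
          using integral_shift_real_ivl[of "T - t" "T - t" T "\<lambda>s. norm (g s)"] by simp
        also have "\<dots> \<le> I"
          unfolding I_def using t by (intro integral_subset_le gi) auto
        finally show ?thesis using M L by (simp add: mult_left_mono)
      qed
      have I: "I \<ge> 0" unfolding I_def by (intro integral_nonneg gi) auto
      \<comment> \<open>A control impulse starts from a state that every functional annihilates, so
        only the integral part of \<open>est\<close> remains.\<close>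
      have DV: "norm (D (V \<tau>)) \<le> M * L * b * I * norm (u \<tau>)" if \<tau>: "\<tau> \<in> {0..T}" for \<tau>
      proof -
        have "(\<Sum>i\<in>K. c i * exp (- z i * of_real (T - (T - \<tau>))) * f (z i) (\<B> (u \<tau>))) = 0"
          using K by (intro sum.neutral) (auto simp: fB)
        then have "norm (D (V \<tau>)) \<le> M * L * norm (\<B> (u \<tau>)) * I"
          using est[of "T - \<tau>" "\<B> (u \<tau>)"] \<tau> by (simp add: V_def)
        also have "\<dots> \<le> M * L * (norm (u \<tau>) * b) * I"
          using M L I by (intro mult_right_mono mult_left_mono b) auto
        finally show ?thesis by (simp add: mult_ac)
      qed
      have DI: "norm (D (LINT \<tau>|lebesgue_on {0..T}. V \<tau>)) \<le> M * L * b * A * I"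
      proof (cases "integrable (lebesgue_on {0..T}) V") \<comment> \<open>otherwise the integral is \<open>0\<close>\<close>
        case True
        then have "D (LINT \<tau>|lebesgue_on {0..T}. V \<tau>) = (LINT \<tau>|lebesgue_on {0..T}. D (V \<tau>))"
          by (intro integral_bounded_linear[OF D, symmetric]) simp
        also have "norm \<dots> \<le> (LINT \<tau>|lebesgue_on {0..T}. norm (D (V \<tau>)))"
          by (rule integral_norm_bound)
        also have "\<dots> \<le> (LINT \<tau>|lebesgue_on {0..T}. M * L * b * I * norm (u \<tau>))"
        proof (rule Bochner_Integration.integral_mono)
          show "integrable (lebesgue_on {0..T}) (\<lambda>\<tau>. norm (D (V \<tau>)))"
            by (intro integrable_norm integrable_bounded_linear[OF D] True)
          show "integrable (lebesgue_on {0..T}) (\<lambda>\<tau>. M * L * b * I * norm (u \<tau>))"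
            using ui by simp
        qed (simp add: DV)
        finally show ?thesis by (simp add: A_def mult_ac)
      next
        case False
        then show ?thesis
          using M L b A I by (simp add: not_integrable_integral_eq D.zero)
      qed
      have "D (S T x) = - D (LINT \<tau>|lebesgue_on {0..T}. V \<tau>)"
        using arg_cong[OF 0, of D] by (simp add: D.add D.zero V_def add_eq_0_iff)
      then have "norm (D (S T x)) \<le> M * L * b * A * I" using DI by simp
      moreover have "norm (D (S T x) - (\<Sum>i\<in>K. c i * f (z i) x)) \<le> M * L * norm x * I"
        using est[of T x] T by simp
      ultimately have "norm (\<Sum>i\<in>K. c i * f (z i) x) \<le> M * L * b * A * I + M * L * norm x * I"
        using norm_triangle_ineq3[of "\<Sum>i\<in>K. c i * f (z i) x" "D (S T x)"]
        by (simp add: norm_minus_commute)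
      then show "norm (\<Sum>i\<in>K. c i * f (z i) x) \<le> (M * L * norm x + M * L * b * A)
          * integral {0..T} (\<lambda>s. norm (\<Sum>i\<in>K. c i * exp (- z i * of_real s)))"
        unfolding I_def g_def by (simp add: algebra_simps)
    qed
  qed
qed

section \<open>An unbounded history and its averages\<close>

text \<open>The square has exponent \<open>-1/2\<close>, which is integrable across the singularity,
  while the function itself is unbounded near \<open>-1/2\<close>, where
  \<open>(sin (pi * s))\<^sup>2\<close> has its peak.\<close>

lemma square_integrable_hist_spike:
  "square_integrable hist_measure (\<lambda>s::real. \<bar>s + 1/2\<bar> powr (-1/4))"
  unfolding square_integrable_def
proof
  show "(\<lambda>s::real. \<bar>s + 1/2\<bar> powr (-1/4)) \<in> borel_measurable hist_measure"
    by (rule borel_imp_hist_measurable) measurable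
  \<comment> \<open>The square of the spike with the singularity moved to \<open>0\<close>: the left
    half follows by reflection, and a shift by \<open>1/2\<close> restores the interval.\<close>
  define f where "f s = \<bar>s\<bar> powr (-1/2)" for s :: real
  have "f integrable_on {0..1/2}"
  proof -
    have "(\<lambda>s::real. s powr (-1/2)) integrable_on {0..1/2}"
      using has_integral_powr_from_0[of "-1/2" "1/2"] by (auto simp: integrable_on_def)
    then show ?thesis
      by (rule integrable_eq) (simp add: f_def)
  qed
  then obtain i where i: "(f has_integral i) {0..1/2}" by (auto simp: integrable_on_def)
  have "((\<lambda>s. f (- s)) has_integral i) {-(1/2)..-0}"
    using has_integral_reflect_lemma_real[OF i] .
  then have "(f has_integral i) {-(1/2)..0}" by (simp add: f_def[abs_def])
  from has_integral_combine[OF _ _ this i]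
  have "(f has_integral i + i) {-(1/2)..1/2}" by simp
  from has_integral_shift_real_ivl[OF this, of "1/2"]
  have "(\<lambda>s. f (s + 1/2)) integrable_on {-1..0}" by (auto simp: integrable_on_def)
  then have "(\<lambda>s. f (s + 1/2)) absolutely_integrable_on {-1..0}"
    by (rule nonnegative_absolutely_integrable_1) (simp add: f_def)
  then have "integrable hist_measure (\<lambda>s. f (s + 1/2))"
    unfolding set_integrable_def by (subst integrable_restrict_space) auto
  moreover have "f (s + 1/2) = (norm (\<bar>s + 1/2\<bar> powr (-1/4)))\<^sup>2" for s :: real
    by (simp add: f_def power2_eq_square powr_add[symmetric])
  ultimately show "integrable hist_measure (\<lambda>s::real. (norm (\<bar>s + 1/2\<bar> powr (-1/4)))\<^sup>2)"
    by simp
qed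

text \<open>This exhibits the weight as a function of the distance to \<open>-1/2\<close>,
  decreasing in it on the history interval.\<close>

lemma sin_squared_eq_cos_shift: "(sin (pi * s))\<^sup>2 = (cos (pi * \<bar>s + 1/2\<bar>))\<^sup>2"
proof -
  have "cos (pi * \<bar>s + 1/2\<bar>) = cos (pi * (s + 1/2))"
    using cos_abs_real[of "pi * (s + 1/2)"] by (simp only: abs_mult abs_of_pos[OF pi_gt_zero])
  also have "\<dots> = - sin (pi * s)"
    by (simp add: distrib_left cos_add)
  finally show ?thesis by simp
qed

text \<open>The weights concentrate at the singularity of the spike, so averaging the spike against
  them is not bounded.\<close>

lemma spike_average_unbounded:
  "\<not> (\<forall>N. (LINT s|hist_measure. (sin (pi * s))\<^sup>2 ^ N * \<bar>s + 1/2\<bar> powr (-1/4))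
      \<le> C * (LINT s|hist_measure. (sin (pi * s))\<^sup>2 ^ N))"
proof
  define h where "h s = (sin (pi * s))\<^sup>2" for s :: real
  define q where "q s = \<bar>s + 1/2\<bar> powr (-1/4)" for s :: real
  assume "\<forall>N. (LINT s|hist_measure. (sin (pi * s))\<^sup>2 ^ N * \<bar>s + 1/2\<bar> powr (-1/4))
      \<le> C * (LINT s|hist_measure. (sin (pi * s))\<^sup>2 ^ N)"
  then have C: "(LINT s|hist_measure. h s ^ N * q s) \<le> C * (LINT s|hist_measure. h s ^ N)" for N
    by (simp add: h_def q_def)
  define K where "K = max 1 C"
  have K: "K \<ge> 1" "K \<ge> C" by (auto simp: K_def)
  \<comment> \<open>The bound \<open>(2 * K) powr (-4)\<close> makes the spike at least
    \<open>2 * K\<close> within distance \<open>\<delta>\<close> of \<open>-1/2\<close>; the bound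
    \<open>1/4\<close> keeps \<open>cos (pi * \<delta>)\<close> positive and the neighbourhood
    inside the interval.\<close>
  define \<delta> where "\<delta> = min (1/4) ((2 * K) powr (-4))"
  have \<delta>: "\<delta> > 0" "\<delta> \<le> 1/4" "\<delta> \<le> (2 * K) powr (-4)"
    using K by (auto simp: \<delta>_def)
  have h01: "0 \<le> h s" "h s \<le> 1" for s
    by (simp_all add: h_def abs_square_le_1)
  have hc: "continuous_on A (\<lambda>s. h s ^ N)" for A N
    unfolding h_def by (intro continuous_intros)
  have hi: "integrable hist_measure (\<lambda>s. h s ^ N)" for N
    by (intro continuous_imp_integrable_real hc)
  have one: "integrable hist_measure (\<lambda>x. 1::real)" "(LINT x|hist_measure. 1::real) = 1"
    by (simp_all add: integrable_restrict_UNIV measure_restrict_space)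
  have qi: "integrable hist_measure q"
    unfolding q_def by (rule square_integrable_hist_integrable[OF square_integrable_hist_spike])
  have hqi: "integrable hist_measure (\<lambda>s. h s ^ N * q s)" for N
  proof (rule Bochner_Integration.integrable_bound[OF qi])
    show "(\<lambda>s. h s ^ N * q s) \<in> borel_measurable hist_measure"
      using hi[of N] qi by (intro borel_measurable_times) auto
    show "AE s in hist_measure. norm (h s ^ N * q s) \<le> norm (q s)"
      using h01 by (intro AE_I2) (simp add: abs_mult mult_left_le_one_le power_le_one)
  qed
  \<comment> \<open>\<open>\<alpha>\<close> bounds the weight from above outside distance
    \<open>\<delta>\<close>, and \<open>\<beta>\<close> bounds it from below within distance
    \<open>\<delta> / 2\<close>. The gap between them drives the contradiction as \<open>N\<close>
    grows.\<close>
  define \<alpha> where "\<alpha> = (cos (pi * \<delta>))\<^sup>2"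
  define \<beta> where "\<beta> = (cos (pi * (\<delta> / 2)))\<^sup>2"
  have cos_pos: "0 < cos (pi * \<delta>)"
    using \<delta> by (intro cos_gt_zero_pi) (auto intro: less_le_trans[of _ 0])
  have cos_less: "cos (pi * \<delta>) < cos (pi * (\<delta> / 2))"
    using \<delta> by (intro cos_monotone_0_pi) auto
  have \<alpha>\<beta>: "0 < \<alpha>" "\<alpha> < \<beta>"
    using cos_pos cos_less by (auto simp: \<alpha>_def \<beta>_def intro!: power_strict_mono)
  have far: "h s \<le> \<alpha>" if "s \<in> {-1..0}" "\<bar>s + 1/2\<bar> \<ge> \<delta>" for s
  proof -
    have a: "\<bar>s + 1/2\<bar> \<le> 1/2" using that(1) by (intro abs_leI) auto
    then have "cos (pi * \<bar>s + 1/2\<bar>) \<le> cos (pi * \<delta>)"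
      using that \<delta> by (intro cos_monotone_0_pi_le) auto
    moreover have "0 \<le> cos (pi * \<bar>s + 1/2\<bar>)"
      using a by (intro cos_ge_zero) (auto intro: order_trans[of _ 0])
    ultimately show ?thesis
      by (simp add: h_def \<alpha>_def sin_squared_eq_cos_shift power_mono)
  qed
  have near: "\<beta> \<le> h s" if "\<bar>s + 1/2\<bar> \<le> \<delta> / 2" for s
  proof -
    have "cos (pi * (\<delta> / 2)) \<le> cos (pi * \<bar>s + 1/2\<bar>)"
      using that \<delta> by (intro cos_monotone_0_pi_le) auto
    then show ?thesis
      using cos_pos cos_less by (simp add: h_def \<beta>_def sin_squared_eq_cos_shift power_mono)
  qed
  \<comment> \<open>The centre is excluded because \<open>0 powr (-1/4)\<close> is \<open>0\<close>;
    it is a null set.\<close>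
  have q: "2 * K \<le> q s" if "\<bar>s + 1/2\<bar> < \<delta>" "s \<noteq> -1/2" for s
  proof -
    have "2 * K = ((2 * K) powr (-4)) powr (-1/4)"
      using K by (simp add: powr_powr)
    also have "\<dots> \<le> \<bar>s + 1/2\<bar> powr (-1/4)"
      using that \<delta> by (intro powr_mono2') auto
    finally show ?thesis by (simp add: q_def)
  qed
  \<comment> \<open>Near \<open>-1/2\<close> the spike exceeds \<open>2 * K\<close>, elsewhere
    \<open>h s ^ N\<close> is at most \<open>\<alpha> ^ N\<close>. The factor \<open>2\<close>
    leaves one copy of \<open>K\<close> times the integral after the assumed bound has absorbed the
    other.\<close>
  have upper: "(LINT s|hist_measure. h s ^ N) \<le> 2 * \<alpha> ^ N" for N
  proof -
    have "(LINT s|hist_measure. 2 * K * h s ^ N - 2 * K * \<alpha> ^ N * 1) \<le> (LINT s|hist_measure. h s ^ N * q s)"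
    proof (rule integral_mono_AE)
      show "integrable hist_measure (\<lambda>s. 2 * K * h s ^ N - 2 * K * \<alpha> ^ N * 1)"
        using hi one by (intro Bochner_Integration.integrable_diff integrable_mult_right) auto
      have "AE s in lebesgue. s \<noteq> (-1/2 :: real)"
        by (rule AE_completion) (rule AE_lborel_singleton)
      then have "AE s in hist_measure. s \<noteq> -1/2"
        by (subst AE_restrict_space_iff) auto
      then show "AE s in hist_measure. 2 * K * h s ^ N - 2 * K * \<alpha> ^ N * 1 \<le> h s ^ N * q s"
        using AE_space
      proof eventually_elim
        case (elim s)
        show ?case
        proof (cases "\<bar>s + 1/2\<bar> < \<delta>")
          case True
          have "2 * K * h s ^ N \<le> h s ^ N * q s"
            using mult_left_mono[OF q[OF True elim(1)], of "h s ^ N"] h01 by (simp add: mult_ac)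
          moreover have "0 \<le> 2 * K * \<alpha> ^ N" using K \<alpha>\<beta> by simp
          ultimately show ?thesis by linarith
        next
          case False
          then have "h s ^ N \<le> \<alpha> ^ N"
            using elim h01 far[of s] by (intro power_mono) auto
          then have "2 * K * h s ^ N \<le> 2 * K * \<alpha> ^ N"
            using K by (intro mult_left_mono) auto
          moreover have "0 \<le> h s ^ N * q s" using h01 by (simp add: q_def)
          ultimately show ?thesis by linarith
        qed
      qed
    qed (rule hqi)
    also have "\<dots> \<le> C * (LINT s|hist_measure. h s ^ N)" by (rule C)
    also have "\<dots> \<le> K * (LINT s|hist_measure. h s ^ N)"
      using K h01 by (intro mult_right_mono) auto
    also have "(LINT s|hist_measure. 2 * K * h s ^ N - 2 * K * \<alpha> ^ N * 1)
        = 2 * K * (LINT s|hist_measure. h s ^ N) - 2 * K * \<alpha> ^ N"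
      using hi one by (subst Bochner_Integration.integral_diff) auto
    finally have "K * (LINT s|hist_measure. h s ^ N) \<le> K * (2 * \<alpha> ^ N)"
      by simp
    then show ?thesis using K by simp
  qed
  \<comment> \<open>Only the interval of length \<open>\<delta>\<close> centred at
    \<open>-1/2\<close> is kept.\<close>
  have lower: "\<delta> * \<beta> ^ N \<le> (LINT s|hist_measure. h s ^ N)" for N
  proof -
    define A where "A = {-1/2 - \<delta> / 2..-1/2 + \<delta> / 2}"
    have A: "A \<subseteq> {-1..0}" using \<delta> by (auto simp: A_def)
    have hk: "(LINT s|hist_measure. h s ^ N) = integral {-1..0} (\<lambda>s. h s ^ N)"
      by (rule lebesgue_integral_eq_integral[OF hi]) simp
    have "\<delta> * \<beta> ^ N = integral A (\<lambda>s. \<beta> ^ N)"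
      using \<delta> by (simp add: A_def)
    also have "\<dots> \<le> integral A (\<lambda>s. h s ^ N)"
      unfolding A_def using \<alpha>\<beta>
      by (intro integral_le integrable_continuous_real hc continuous_intros power_mono near)
        (auto simp: abs_if)
    also have "\<dots> \<le> integral {-1..0} (\<lambda>s. h s ^ N)"
      using A h01 by (intro integral_subset_le) (auto simp: A_def intro!: integrable_continuous_real hc)
    finally show ?thesis by (simp add: hk)
  qed
  have "\<delta> / 2 \<le> (\<alpha> / \<beta>) ^ N" for N
  proof -
    have "\<delta> * \<beta> ^ N \<le> 2 * \<alpha> ^ N" using order_trans[OF lower upper] .
    then show ?thesis using \<alpha>\<beta> by (simp add: power_divide field_simps)
  qed
  moreover have "(\<lambda>N. (\<alpha> / \<beta>) ^ N) \<longlonglongrightarrow> 0"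
    using \<alpha>\<beta> by (intro LIMSEQ_realpow_zero) auto
  ultimately have "\<delta> / 2 \<le> 0" by (intro LIMSEQ_le_const) auto
  with \<delta> show False by simp
qed

section \<open>Periodic weights as exponential sums\<close>

text \<open>The weight has period 1, so \<open>{0..T}\<close> is covered by \<open>n\<close>
  periods, each with the same integral as the history interval. This compares the L1 norm over the
  control time with the average over the history.\<close>

lemma integral_sin_power_le:
  assumes "T \<le> real n"
  shows "integral {0..T} (\<lambda>s. (sin (pi * s))\<^sup>2 ^ N) \<le> real n * (LINT s|hist_measure. (sin (pi * s))\<^sup>2 ^ N)"
proof -
  define h where "h s = (sin (pi * s))\<^sup>2 ^ N" for s :: real
  have hi: "h integrable_on {a..b}" for a b
    unfolding h_def by (intro integrable_continuous_real continuous_intros)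
  have per: "h (s + 1) = h s" for s
    by (simp add: h_def distrib_left)
  have step: "integral {real k - 1..real k} h = integral {-1..0} h" for k
  proof (induction k)
    case (Suc k)
    have "integral {real k..real k + 1} h = integral {real k - 1..real k} (\<lambda>s. h (s + 1))"
      using integral_shift_real_ivl[of "real k" 1 "real k + 1" h] by simp
    then show ?case using Suc by (simp add: per add.commute)
  qed simp
  have "integral {0..real n} h = real n * integral {-1..0} h"
  proof (induction n)
    case (Suc n)
    have "integral {0..real (Suc n)} h = integral {0..real n} h + integral {real n..real (Suc n)} h"
      by (rule Henstock_Kurzweil_Integration.integral_combine[symmetric, OF _ _ hi]) auto
    then show ?case using Suc step[of "Suc n"] by (simp add: algebra_simps)
  qed simp
  moreover have "integral {0..T} h \<le> integral {0..real n} h"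
    using assms by (intro integral_subset_le hi) (auto simp: h_def)
  moreover have "(LINT s|hist_measure. h s) = integral {-1..0} h"
    unfolding h_def by (intro lebesgue_integral_eq_integral continuous_imp_integrable_real continuous_intros) simp
  ultimately show ?thesis by (simp add: h_def[abs_def])
qed

text \<open>With \<open>E = exp (- 2 * pi * i * s)\<close>, the sum is \<open>exp (- a * s)\<close> times the \<open>N\<close>-th power of
  \<open>(1 - E)\<^sup>2 / E\<close>.\<close>

lemma exponential_sum_eq_sin_power:
  "(\<Sum>j\<le>2 * N. of_nat ((2 * N) choose j) * (-1) ^ j
      * exp (- (a + 2 * of_real pi * \<i> * (of_nat j - of_nat N)) * of_real s))
    = exp (- a * of_real s) * of_real ((-4 * (sin (pi * s))\<^sup>2) ^ N)"
proof -
  define E where "E = exp (- (2 * of_real pi * \<i>) * of_real s)"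
  have E0: "E \<noteq> 0" by (simp add: E_def)
  have e: "exp (- (a + 2 * of_real pi * \<i> * (of_nat j - of_nat N)) * of_real s)
      = exp (- a * of_real s) * (E ^ j * inverse E ^ N)" for j
  proof -
    have "- (a + 2 * of_real pi * \<i> * (of_nat j - of_nat N)) * of_real s
        = - a * of_real s + (of_nat j * (- (2 * of_real pi * \<i>) * of_real s)
          + of_nat N * (- (- (2 * of_real pi * \<i>) * of_real s)))"
      by (simp add: algebra_simps)
    then show ?thesis
      by (simp only: exp_add exp_of_nat_mult exp_minus E_def)
  qed
  \<comment> \<open>\<open>E\<close> lies on the unit circle, so \<open>(1 - E)\<^sup>2 / E\<close>
    is real: it is \<open>2 * cos (2 * pi * s) - 2\<close>, and the double angle formula gives the
    square of the sine.\<close>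
  have "E + inverse E = 2 * cos (of_real (2 * (pi * s)))"
    unfolding E_def cos_exp_eq exp_minus[symmetric] by (simp add: mult_ac add.commute)
  then have cosE: "E + inverse E - 2 = of_real (2 * cos (2 * (pi * s)) - 2)"
    by (simp only: cos_of_real) simp
  have "(1 - E)\<^sup>2 * inverse E = E + inverse E - 2"
    using E0 by (simp add: power2_eq_square field_simps)
  also have "\<dots> = of_real (-4 * (sin (pi * s))\<^sup>2)"
    unfolding cosE cos_double_sin by simp
  finally have sq: "(1 - E)\<^sup>2 * inverse E = of_real (-4 * (sin (pi * s))\<^sup>2)" .
  have "(\<Sum>j\<le>2 * N. of_nat ((2 * N) choose j) * (-1) ^ j
      * exp (- (a + 2 * of_real pi * \<i> * (of_nat j - of_nat N)) * of_real s))
    = exp (- a * of_real s) * inverse E ^ N * (\<Sum>j\<le>2 * N. of_nat ((2 * N) choose j) * (- E) ^ j * 1 ^ (2 * N - j))"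
    unfolding e sum_distrib_left
    by (intro sum.cong refl) (simp add: power_minus[of E] mult_ac)
  also have "\<dots> = exp (- a * of_real s) * inverse E ^ N * (1 - E) ^ (2 * N)"
    by (simp only: binomial_ring[symmetric]) simp
  also have "\<dots> = exp (- a * of_real s) * ((1 - E)\<^sup>2 * inverse E) ^ N"
    by (simp add: power_mult[symmetric] power_mult_distrib mult_ac)
  finally show ?thesis by (simp add: sq)
qed

section \<open>Exponential functionals and the delay matrix\<close>

text \<open>Integration by parts leaves \<open>w\<close> paired with \<open>\<phi> 0\<close> and
  \<open>exp z * w\<close> paired with \<open>\<phi> (-1)\<close>. As \<open>w\<close> is a left
  eigenvector for \<open>exp z\<close>, the two combine to the pairing of \<open>w\<close> with
  \<open>\<phi> 0 - Am1 *v \<phi> (-1)\<close>, the first component of \<open>x\<close>.\<close>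

lemma exponential_functional_neutral_operator:
  fixes Am1 :: "real ^ 'n ^ 'n"
  defines "k \<equiv> \<lambda>w z s. \<chi> j. exp (- z * complex_of_real s) * w $ j"
  assumes w: "\<And>j. (\<Sum>i\<in>UNIV. w $ i * of_real (Am1 $ i $ j)) = exp z * w $ j"
    and xy: "(x, y) \<in> neutral_operator Am1 A2 A3"
  shows "state_functional 0 (k w z) y
    = z * state_functional 0 (k w z) x + (\<Sum>j\<in>UNIV. w $ j * of_real (fst x $ j))"
proof -
  obtain \<phi> \<phi>' v where H: "H1_hist \<phi> \<phi>'"
    and x: "x = (\<phi> 0 - Am1 *v \<phi> (-1), abs_L2_hist \<phi>)" and y: "y = (v, abs_L2_hist \<phi>')"
    using xy unfolding neutral_operator_def by blast
  have \<phi>: "square_integrable hist_measure \<phi>" by (rule H1_hist_square_integrable[OF H])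
  have \<phi>': "square_integrable hist_measure \<phi>'" using H unfolding H1_hist_def by (rule conjunct1)
  have k: "square_integrable hist_measure (\<lambda>s. k w z s $ j)" for j
    unfolding k_def vec_lambda_beta by (intro continuous_on_square_integrable_hist continuous_intros)
  have ac: "AC_hist (\<lambda>s. k w z s $ j) (\<lambda>s. (\<chi> j. - z * k w z s $ j) $ j)" for j
  proof -
    have "AC_hist (\<lambda>s. w $ j + (LINT r|lebesgue_on {-1..s}. 0)) (\<lambda>s. 0)"
      by (rule AC_hist_antiderivative) simp
    then have "AC_hist (\<lambda>s. w $ j) (\<lambda>s. 0)" by simp
    from AC_hist_mult[OF AC_hist_exp[of "- z"] this] show ?thesis
      by (simp add: k_def mult.assoc)
  qed
  have "state_functional 0 (k w z) y = (\<Sum>j\<in>UNIV. w $ j * of_real (\<phi> 0 $ j))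
      - (\<Sum>j\<in>UNIV. exp z * w $ j * of_real (\<phi> (-1) $ j))
      - (LINT s|hist_measure. (\<Sum>j\<in>UNIV. - z * k w z s $ j * of_real (\<phi> s $ j)))"
    unfolding y state_functional_abs[OF k \<phi>'] integral_by_parts_H1_hist[OF H ac]
    by (simp add: k_def)
  also have "(LINT s|hist_measure. (\<Sum>j\<in>UNIV. - z * k w z s $ j * of_real (\<phi> s $ j)))
      = - z * state_functional 0 (k w z) x"
    unfolding x state_functional_abs[OF k \<phi>] mult.assoc sum_distrib_left[symmetric]
    by simp
  also have "(\<Sum>j\<in>UNIV. w $ j * of_real (\<phi> 0 $ j)) - (\<Sum>j\<in>UNIV. exp z * w $ j * of_real (\<phi> (-1) $ j))
      = (\<Sum>j\<in>UNIV. w $ j * of_real (fst x $ j))"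
    by (simp add: x w[symmetric] sum_matrix_vector_mult[symmetric] right_diff_distrib sum_subtractf)
  finally show ?thesis by simp
qed

text \<open>Putting the history into a single coordinate reduces the functional to a scalar
  exponential moment of \<open>r\<close>, which carries information as soon as \<open>w $ i\<close>
  is nonzero.\<close>

lemma exponential_functional_axis:
  assumes r: "square_integrable hist_measure r"
  shows "state_functional 0 (\<lambda>s. \<chi> j. exp (- z * complex_of_real s) * w $ j) (v, abs_L2_hist (\<lambda>s. axis i (r s)))
    = w $ i * (LINT s|hist_measure. exp (- z * of_real s) * of_real (r s))"
proof -
  have "square_integrable hist_measure (\<lambda>s. (\<chi> j. exp (- z * complex_of_real s) * w $ j) $ j)" for j
    unfolding vec_lambda_beta by (intro continuous_on_square_integrable_hist continuous_intros)
  moreover have "square_integrable hist_measure (\<lambda>s. axis i (r s))"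
    by (rule square_integrable_bounded_linear[OF bounded_linear_axis r])
  ultimately have "state_functional 0 (\<lambda>s. \<chi> j. exp (- z * complex_of_real s) * w $ j) (v, abs_L2_hist (\<lambda>s. axis i (r s)))
    = (LINT s|hist_measure. (\<Sum>j\<in>UNIV. exp (- z * complex_of_real s) * w $ j * of_real (axis i (r s) $ j)))"
    by (simp add: state_functional_abs)
  also have "(\<lambda>s. \<Sum>j\<in>UNIV. exp (- z * complex_of_real s) * w $ j * of_real (axis i (r s) $ j))
      = (\<lambda>s. w $ i * (exp (- z * of_real s) * of_real (r s)))"
    by (rule ext) (simp add: axis_def if_distrib mult_ac cong: if_cong)
  finally show ?thesis by simp
qed

lemma continuous_mult_square_integrable_hist:
  assumes r: "continuous_on {-1..0} r" and q: "square_integrable hist_measure q"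
  shows "square_integrable hist_measure (\<lambda>s. r s * q s :: real)"
proof -
  obtain K where "\<forall>y\<in>r ` {-1..0}. norm y \<le> K"
    using compact_imp_bounded[OF compact_continuous_image[OF r compact_Icc]]
    unfolding bounded_iff by blast
  then have K: "norm (r s) \<le> K" if "s \<in> {-1..0}" for s using that by blast
  have m: "(\<lambda>s. r s * q s) \<in> borel_measurable hist_measure"
    using square_integrable_measurable[OF continuous_on_square_integrable_hist[OF r]]
      square_integrable_measurable[OF q] by measurable
  show ?thesis
    unfolding square_integrable_def
  proof (rule conjI[OF m], rule Bochner_Integration.integrable_bound)
    show "integrable hist_measure (\<lambda>s. K\<^sup>2 * (norm (q s))\<^sup>2)"
      using square_integrable_norm2[OF q] by simp
    show "(\<lambda>s. (norm (r s * q s))\<^sup>2) \<in> borel_measurable hist_measure"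
      using m by measurable
    show "AE s in hist_measure. norm ((norm (r s * q s))\<^sup>2) \<le> norm (K\<^sup>2 * (norm (q s))\<^sup>2)"
    proof (rule AE_I2)
      fix s assume "s \<in> space hist_measure"
      then have "(norm (r s))\<^sup>2 \<le> K\<^sup>2" by (intro power_mono K) auto
      then show "norm ((norm (r s * q s))\<^sup>2) \<le> norm (K\<^sup>2 * (norm (q s))\<^sup>2)"
        by (simp add: power_mult_distrib mult_right_mono)
    qed
  qed
qed

text \<open>The L1 estimate, applied to logarithms of \<open>\<mu>\<close> with binomial
  coefficients, would bound the averages of the spike uniformly in \<open>N\<close>, contrary to
  \<open>spike_average_unbounded\<close>.\<close>

lemma exactly_null_controllable_delay_matrix:
  fixes Am1 :: "real ^ 'n ^ 'n" and B :: "real ^ 'm ^ 'n" and w :: "complex ^ 'n"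
  assumes gen: "generates_C0_semigroup (neutral_operator Am1 A2 A3) S"
    and null: "exactly_null_controllable S (control_operator B)"
    and w: "\<And>j. (\<Sum>i\<in>UNIV. w $ i * of_real (Am1 $ i $ j)) = \<mu> * w $ j"
    and \<mu>: "\<mu> \<noteq> 0"
  shows "w = 0"
proof (rule ccontr)
  assume "w \<noteq> 0"
  then obtain i where wi: "w $ i \<noteq> 0" by (auto simp: vec_eq_iff)
  define k where "k z s = (\<chi> j. exp (- z * complex_of_real s) * w $ j)" for z s
  define f where "f z = state_functional 0 (k z)" for z
  define l where "l x = (\<Sum>j\<in>UNIV. w $ j * complex_of_real (fst x $ j))" for x :: "'n M2"
  have S: "C0_semigroup S" using gen by (simp add: generates_C0_semigroup_def)
  have l: "bounded_linear l"
    unfolding l_def[abs_def]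
    by (intro bounded_linear_sum bounded_linear_const_mult bounded_linear_compose[OF bounded_linear_of_real]
        bounded_linear_compose[OF bounded_linear_vec_nth] bounded_linear_fst)
  have B: "bounded_linear (control_operator B)"
    unfolding control_operator_def[abs_def]
    by (intro bounded_linear_Pair matrix_vector_mul_bounded_linear bounded_linear_zero)
  obtain T where T: "T > 0" and bound: "\<And>x. \<exists>C\<ge>0. \<forall>K z c. finite K \<longrightarrow> z ` K \<subseteq> {z. exp z = \<mu>} \<longrightarrow>
    norm (\<Sum>i\<in>K. c i * f (z i) x)
      \<le> C * integral {0..T} (\<lambda>s. norm (\<Sum>i\<in>(K::nat set). c i * exp (- z i * of_real s)))"
  proof (rule exactly_null_controllable_functional_bound[OF S l B _ _ _ null, of "{z. exp z = \<mu>}" f])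
    show "bounded_linear (f z)" for z
      unfolding f_def by (rule bounded_linear_state_functional)
    show "f z (control_operator B u) = 0" for z u
      by (simp add: f_def control_operator_def state_functional_zero_history)
    show "f z y = z * f z x + l x"
      if "z \<in> {z. exp z = \<mu>}" "(x, y) \<in> infinitesimal_generator S" for z x y
      unfolding f_def k_def l_def
      by (rule exponential_functional_neutral_operator)
        (use that gen w in \<open>auto simp: generates_C0_semigroup_def\<close>)
  qed blast
  \<comment> \<open>One logarithm suffices; the other frequencies differ from it by multiples of
    \<open>2 * pi * \<i>\<close>.\<close>
  define a where "a = Ln \<mu>"
  have a: "exp a = \<mu>" using \<mu> by (simp add: a_def)
  define q where "q s = \<bar>s + 1/2\<bar> powr (-1/4)" for s :: real
  have q: "square_integrable hist_measure q"
    unfolding q_def by (rule square_integrable_hist_spike)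
  \<comment> \<open>The real histories \<open>r1\<close> and \<open>r2\<close> combine to \<open>r1 + \<i> * r2 = exp (a * s) * q s\<close>, which cancels
    the phase of the exponentials.\<close>
  define r1 where "r1 s = Re (exp (a * of_real s)) * q s" for s
  define r2 where "r2 s = Im (exp (a * of_real s)) * q s" for s
  have r1: "square_integrable hist_measure r1"
    unfolding r1_def by (intro continuous_mult_square_integrable_hist continuous_intros q)
  have r2: "square_integrable hist_measure r2"
    unfolding r2_def by (intro continuous_mult_square_integrable_hist continuous_intros q)
  define x where "x r = (0::real ^ 'n, abs_L2_hist (\<lambda>s. axis i (r s) :: real ^ 'n))" for r
  define h where "h s = (sin (pi * s))\<^sup>2" for s :: real
  define E where "E = exp (\<bar>Re a\<bar> * T)"
  obtain n where n: "T \<le> real n" using real_arch_simple by blast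
  \<comment> \<open>The state space is real, so the real and imaginary parts of the history are two
    states, each with its own constant; both are obtained before \<open>N\<close> is chosen.\<close>
  obtain C1 where C1: "C1 \<ge> 0" "\<And>K z c. finite K \<Longrightarrow> z ` K \<subseteq> {z. exp z = \<mu>} \<Longrightarrow>
    norm (\<Sum>i\<in>K. c i * f (z i) (x r1))
      \<le> C1 * integral {0..T} (\<lambda>s. norm (\<Sum>i\<in>(K::nat set). c i * exp (- z i * of_real s)))"
    using bound[of "x r1"] by blast
  obtain C2 where C2: "C2 \<ge> 0" "\<And>K z c. finite K \<Longrightarrow> z ` K \<subseteq> {z. exp z = \<mu>} \<Longrightarrow>
    norm (\<Sum>i\<in>K. c i * f (z i) (x r2))
      \<le> C2 * integral {0..T} (\<lambda>s. norm (\<Sum>i\<in>(K::nat set). c i * exp (- z i * of_real s)))"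
    using bound[of "x r2"] by blast
  have "(LINT s|hist_measure. h s ^ N * q s)
      \<le> ((C1 + C2) * E * real n / norm (w $ i)) * (LINT s|hist_measure. h s ^ N)" for N
  proof -
    define z where "z j = a + 2 * of_real pi * \<i> * (of_nat j - of_nat N)" for j :: nat
    define c :: "nat \<Rightarrow> complex" where "c j = of_nat ((2 * N) choose j) * (-1) ^ j" for j
    have z: "z ` {..2 * N} \<subseteq> {z. exp z = \<mu>}"
    proof -
      have "z j = a + complex_of_real (2 * of_int (int j - int N) * pi) * \<i>" for j
        by (simp add: z_def mult_ac)
      then have "exp (z j) = exp a" for j
        by (simp only: exp_add exp_integer_2pi[OF Ints_of_int] mult_1_right)
      then show ?thesis by (auto simp: a)
    qed
    have g: "(\<Sum>j\<le>2 * N. c j * exp (- z j * of_real s)) = exp (- a * of_real s) * of_real ((-4 * h s) ^ N)" for s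
      unfolding c_def z_def h_def by (rule exponential_sum_eq_sin_power)
    define G where "G = integral {0..T} (\<lambda>s. norm (\<Sum>j\<le>2 * N. c j * exp (- z j * of_real s)))"
    \<comment> \<open>The combination has norm at most \<open>E * 4 ^ N * h s ^ N\<close> on
      \<open>{0..T}\<close>, where \<open>E\<close> bounds the norm of
      \<open>exp (- a * of_real s)\<close>; periodicity then passes to the history interval.\<close>
    have G: "G \<le> E * 4 ^ N * (real n * (LINT s|hist_measure. h s ^ N))"
    proof -
      have "G \<le> integral {0..T} (\<lambda>s. E * 4 ^ N * h s ^ N)"
        unfolding G_def
      proof (rule integral_le)
        show "(\<lambda>s. norm (\<Sum>j\<le>2 * N. c j * exp (- z j * of_real s))) integrable_on {0..T}"
          by (intro integrable_continuous_real continuous_intros)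
        show "(\<lambda>s. E * 4 ^ N * h s ^ N) integrable_on {0..T}"
          unfolding h_def by (intro integrable_continuous_real continuous_intros)
        fix s assume s: "s \<in> {0..T}"
        have "- Re a * s \<le> \<bar>Re a\<bar> * s" using s by (intro mult_right_mono) auto
        also have "\<dots> \<le> \<bar>Re a\<bar> * T" using s by (intro mult_left_mono) auto
        finally have "norm (exp (- a * complex_of_real s)) \<le> E"
          by (simp add: E_def norm_exp_eq_Re)
        moreover have "norm (complex_of_real ((-4 * h s) ^ N)) = 4 ^ N * h s ^ N"
          by (simp add: norm_power abs_mult norm_mult power_mult_distrib h_def power_abs)
        ultimately show "norm (\<Sum>j\<le>2 * N. c j * exp (- z j * of_real s)) \<le> E * 4 ^ N * h s ^ N"
          unfolding g norm_mult by (simp add: mult.assoc mult_right_mono h_def)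
      qed
      also have "\<dots> = E * 4 ^ N * integral {0..T} (\<lambda>s. h s ^ N)" by simp
      also have "\<dots> \<le> E * 4 ^ N * (real n * (LINT s|hist_measure. h s ^ N))"
        unfolding h_def using integral_sin_power_le[OF n, of N]
        by (intro mult_left_mono) (auto simp: E_def)
      finally show ?thesis .
    qed
    have fx: "f (z j) (x r) = w $ i * (LINT s|hist_measure. exp (- z j * of_real s) * of_real (r s))"
      if "square_integrable hist_measure r" for j r
      unfolding f_def k_def x_def by (rule exponential_functional_axis[OF that])
    have fr: "integrable hist_measure (\<lambda>s. exp (- z j * of_real s) * complex_of_real (r s))"
      if "square_integrable hist_measure r" for j r
      by (intro square_integrable_mult_integrable square_integrable_bounded_linear[OF bounded_linear_of_real]
          that continuous_on_square_integrable_hist continuous_intros)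
    have fq: "integrable hist_measure (\<lambda>s. exp (- z j * of_real s) * (exp (a * of_real s) * complex_of_real (q s)))" for j
      unfolding mult.assoc[symmetric]
      by (intro square_integrable_mult_integrable square_integrable_bounded_linear[OF bounded_linear_of_real]
          q continuous_on_square_integrable_hist continuous_intros)
    have "(\<Sum>j\<le>2 * N. c j * f (z j) (x r1)) + \<i> * (\<Sum>j\<le>2 * N. c j * f (z j) (x r2))
        = (\<Sum>j\<le>2 * N. c j * w $ i * ((LINT s|hist_measure. exp (- z j * of_real s) * of_real (r1 s))
            + \<i> * (LINT s|hist_measure. exp (- z j * of_real s) * of_real (r2 s))))"
      by (simp add: fx r1 r2 sum_distrib_left sum.distrib algebra_simps)
    also have "\<dots> = (\<Sum>j\<le>2 * N. LINT s|hist_measure. c j * w $ i * (exp (- z j * of_real s) * (exp (a * of_real s) * of_real (q s))))"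
    proof (intro sum.cong refl)
      fix j
      have "(LINT s|hist_measure. exp (- z j * of_real s) * of_real (r1 s))
            + \<i> * (LINT s|hist_measure. exp (- z j * of_real s) * of_real (r2 s))
          = (LINT s|hist_measure. exp (- z j * of_real s) * of_real (r1 s)
            + \<i> * (exp (- z j * of_real s) * of_real (r2 s)))"
        using fr[OF r1, of j] fr[OF r2, of j] by simp
      also have "(\<lambda>s. exp (- z j * of_real s) * of_real (r1 s) + \<i> * (exp (- z j * of_real s) * of_real (r2 s)))
          = (\<lambda>s. exp (- z j * of_real s) * (exp (a * of_real s) * of_real (q s)))"
      proof (rule ext)
        fix s
        have "complex_of_real (r1 s) + \<i> * of_real (r2 s) = exp (a * of_real s) * of_real (q s)"
          by (simp add: r1_def r2_def complex_eq_iff)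
        then show "exp (- z j * of_real s) * of_real (r1 s) + \<i> * (exp (- z j * of_real s) * of_real (r2 s))
            = exp (- z j * of_real s) * (exp (a * of_real s) * of_real (q s))"
          by (metis distrib_left mult.left_commute)
      qed
      finally show "c j * w $ i * ((LINT s|hist_measure. exp (- z j * of_real s) * of_real (r1 s))
            + \<i> * (LINT s|hist_measure. exp (- z j * of_real s) * of_real (r2 s)))
          = (LINT s|hist_measure. c j * w $ i * (exp (- z j * of_real s) * (exp (a * of_real s) * of_real (q s))))"
        by simp
    qed
    also have "\<dots> = (LINT s|hist_measure. (\<Sum>j\<le>2 * N. c j * w $ i * (exp (- z j * of_real s) * (exp (a * of_real s) * of_real (q s)))))"
      by (intro Bochner_Integration.integral_sum[symmetric] integrable_mult_right fq)
    also have "\<dots> = (LINT s|hist_measure. w $ i * (-4) ^ N * of_real (h s ^ N * q s))"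
    proof (intro Bochner_Integration.integral_cong refl)
      fix s
      have "(\<Sum>j\<le>2 * N. c j * w $ i * (exp (- z j * of_real s) * (exp (a * of_real s) * of_real (q s))))
          = w $ i * exp (a * of_real s) * of_real (q s) * (\<Sum>j\<le>2 * N. c j * exp (- z j * of_real s))"
        by (simp add: sum_distrib_left mult_ac)
      also have "\<dots> = w $ i * (exp (a * of_real s) * exp (- a * of_real s)) * of_real (q s) * of_real ((-4 * h s) ^ N)"
        unfolding g by (simp only: mult_ac)
      \<comment> \<open>The phase built into the histories cancels that of the exponential sum,
        leaving a nonnegative integrand up to the constant \<open>w $ i * (-4) ^ N\<close>.\<close>
      also have "exp (a * complex_of_real s) * exp (- a * of_real s) = 1"
        by (simp add: exp_add[symmetric])
      also have pw: "complex_of_real ((-4 * h s) ^ N) = (-4) ^ N * of_real (h s ^ N)"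
        by (simp only: power_mult_distrib of_real_mult of_real_power of_real_neg_numeral)
      finally show "(\<Sum>j\<le>2 * N. c j * w $ i * (exp (- z j * of_real s) * (exp (a * of_real s) * of_real (q s))))
          = w $ i * (-4) ^ N * of_real (h s ^ N * q s)"
        by (simp only: mult_1_left mult_1_right of_real_mult mult_ac)
    qed
    also have "\<dots> = w $ i * (-4) ^ N * of_real (LINT s|hist_measure. h s ^ N * q s)"
      by (simp del: of_real_mult of_real_power)
    finally have eq: "w $ i * (-4) ^ N * of_real (LINT s|hist_measure. h s ^ N * q s)
        = (\<Sum>j\<le>2 * N. c j * f (z j) (x r1)) + \<i> * (\<Sum>j\<le>2 * N. c j * f (z j) (x r2))" by simp
    have "0 \<le> (LINT s|hist_measure. h s ^ N * q s)" by (simp add: h_def q_def)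
    then have "norm (w $ i) * 4 ^ N * (LINT s|hist_measure. h s ^ N * q s)
        = norm (w $ i * (-4) ^ N * of_real (LINT s|hist_measure. h s ^ N * q s))"
      by (simp add: norm_mult norm_power)
    also have "\<dots> \<le> norm (\<Sum>j\<le>2 * N. c j * f (z j) (x r1)) + norm (\<Sum>j\<le>2 * N. c j * f (z j) (x r2))"
      unfolding eq by (rule order_trans[OF norm_triangle_ineq]) (simp add: norm_mult)
    also have "\<dots> \<le> C1 * G + C2 * G"
      unfolding G_def by (intro add_mono C1(2) C2(2) z) auto
    also have "\<dots> \<le> (C1 + C2) * (E * 4 ^ N * (real n * (LINT s|hist_measure. h s ^ N)))"
      using C1(1) C2(1) mult_left_mono[OF G, of "C1 + C2"] by (simp add: algebra_simps)
    \<comment> \<open>The growth \<open>4 ^ N\<close> occurs on both sides, so cancelling it leaves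
      a constant independent of \<open>N\<close>.\<close>
    finally have "4 ^ N * (norm (w $ i) * (LINT s|hist_measure. h s ^ N * q s))
        \<le> 4 ^ N * ((C1 + C2) * E * real n * (LINT s|hist_measure. h s ^ N))"
      by (simp add: mult_ac)
    then have "norm (w $ i) * (LINT s|hist_measure. h s ^ N * q s)
        \<le> (C1 + C2) * E * real n * (LINT s|hist_measure. h s ^ N)"
      by (subst (asm) mult_le_cancel_left_pos) simp_all
    then show ?thesis using wi by (simp add: field_simps)
  qed
  then show False
    unfolding h_def q_def using spike_average_unbounded by blast
qed

theorem theorem3p4:
  fixes Am1 :: "real ^ 'n ^ 'n" and B :: "real ^ 'm ^ 'n"
    and A2 A3 :: "real \<Rightarrow> real ^ 'n ^ 'n"
    and S :: "real \<Rightarrow> 'n M2 \<Rightarrow> 'n M2"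
  assumes "\<And>i j. square_integrable hist_measure (\<lambda>\<theta>. A2 \<theta> $ i $ j)"
    and "\<And>i j. square_integrable hist_measure (\<lambda>\<theta>. A3 \<theta> $ i $ j)"
    and "generates_C0_semigroup (neutral_operator Am1 A2 A3) S"
    and "exactly_null_controllable S (control_operator B)"
  shows "(\<forall>z. rank (append_columns (char_matrix Am1 A2 A3 z) (complex_matrix B)) = CARD('n)) \<and>
         (\<forall>\<mu>. \<mu> \<noteq> 0 \<longrightarrow>
            rank (append_columns (mat \<mu> - complex_matrix Am1) (complex_matrix B)) = CARD('n))"
proof (intro conjI allI impI)
  show "rank (append_columns (char_matrix Am1 A2 A3 z) (complex_matrix B)) = CARD('n)" for z
    by (rule char_matrix_full_rank[OF assms])
  show "rank (append_columns (mat \<mu> - complex_matrix Am1) (complex_matrix B)) = CARD('n)"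
    if \<mu>: "\<mu> \<noteq> 0" for \<mu>
  proof (rule ccontr)
    assume "\<not> ?thesis"
    then obtain w :: "complex ^ 'n" where w: "w \<noteq> 0"
      "\<And>j. (\<Sum>i\<in>UNIV. w $ i * append_columns (mat \<mu> - complex_matrix Am1) (complex_matrix B) $ i $ j) = 0"
      using rank_less_imp_left_kernel by blast
    \<comment> \<open>The first block of the null vector equation makes \<open>w\<close> a left
      eigenvector of \<open>Am1\<close> for the nonzero eigenvalue \<open>\<mu>\<close>.\<close>
    have "(\<Sum>i\<in>UNIV. w $ i * of_real (Am1 $ i $ j)) = \<mu> * w $ j" for j
    proof -
      have "(\<Sum>i\<in>UNIV. w $ i * mat \<mu> $ i $ j) = \<mu> * w $ j"
        by (simp add: mat_def if_distrib cong: if_cong)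
      then show ?thesis
        using append_columns_left_kernel(1)[OF w(2), of j]
        by (simp add: complex_matrix_def right_diff_distrib sum_subtractf)
    qed
    from exactly_null_controllable_delay_matrix[OF assms(3,4) this \<mu>] w(1) show False by simp
  qed
qed

end
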